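(* Let $\Theta$ be a metric space and $\Psi:\Theta\times\mathbb{R}\to\mathbb{R}$ jointly measurable, Lipschitz in the second argument, and such that for every $x\in\mathbb{R}$ the map $\theta\mapsto\Psi(\theta,x)$ is continuous. Let $\omega$ be a random element of $\Theta$, $\Psi=\Psi(\omega,\cdot)$, $L(\Psi)$ its Lipschitz constant, and assume $\mathbb{E}\log L(\Psi)<0$ and $\mathbb{E}\log^+|\Psi(\omega,0)|<\infty$. Let $X$ be the stationary solution ($X\overset{d}{=}\Psi(X)$, $X$ independent of $\Psi$) with law $\nu$. Assume there is a random pair $(A,B)\in(0,\infty)\times\mathbb{R}$ (depending on $\omega$) such that almost surely $$Ax-B\le\Psi(x)\le Ax+B\qquad\text{for }x\in\operatorname{supp}\nu,$$ and that $\mathbb{E}\log A<0$, $\mathbb{E}A^\alpha=1$ for some $\alpha>0$, $\mathbb{E}[|B|^\alpha+A^\alpha\log^+A]<\infty$, and the law of $\log A$ is non-arithmetic. Under these hypotheses the limit $C_+=\lim_{t\to\infty}t^\alpha\mathbb{P}[X>t]$ exists. If the support of $\nu$ is unbounded at $+\infty$, then $C_+>0$.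
   Context: The law of $\log A$ is non-arithmetic if it is not supported on $c\mathbb{Z}$ for any $c>0$. "Unbounded at $+\infty$" means not bounded from above. *)

theory Defs
  imports "HOL-Probability.Probability"
begin

definition lnplus :: "real \<Rightarrow> real" where
  "lnplus x = (if x \<le> 1 then 0 else ln x)"

definition lnminus :: "real \<Rightarrow> ennreal" where
  "lnminus x = (if x \<le> 0 then \<infinity> else ennreal (max 0 (- ln x)))"

text \<open>E log f < 0 in the extended sense: E log^+ f < E log^- f.\<close>
definition neg_log_mean :: "'a measure \<Rightarrow> ('a \<Rightarrow> real) \<Rightarrow> bool" where
  "neg_log_mean P f \<longleftrightarrow>
     (\<integral>\<^sup>+ w. ennreal (lnplus (f w)) \<partial>P) < (\<integral>\<^sup>+ w. lnminus (f w) \<partial>P)"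

definition lip_const :: "(real \<Rightarrow> real) \<Rightarrow> real" where
  "lip_const f = Inf {L. L-lipschitz_on UNIV f}"

definition msupp :: "real measure \<Rightarrow> real set" where
  "msupp \<nu> = {x. \<forall>e>0. emeasure \<nu> (ball x e) > 0}"

end

theory Submission
  imports Defs
begin

text \<open>
  Put $V = \log A$, let $Q$ have density $A^\alpha$ with respect to $P$, and for a nonnegative
  stationary functional $Z$ write $r(t) = e^{\alpha t} P[Z > e^t]$. Then
  $r(t) = g(t) + E_Q\, r(t - V)$ with $g$ integrable, and no renewal measure is needed to find
  the limit of $r$. First, $r$ is bounded: since $E_Q e^{-bV} < 1$ for small $b > 0$, the function
  $\min(1, e^{bx})$ is a strict supersolution near $0$, so its convolution with $|g|$ dominates the
  window averages of $r$. Secondly, the window averages $f(t) = \int_t^{t+h} r$ are Lipschitz and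
  $f(t) - E_Q f(t - V) \to 0$, so if $f(t_n)$ tends to the upper limit of $f$ then so does
  $f(t_n - x)$ for every $x$ in the closed semigroup generated by the support of $V$, which is the
  whole line. Integrating the equation over a half-line gives
  $E_Q \int_{t-V}^t f \to h \int g$, which identifies this upper limit (and likewise the lower
  one) as $h \int g / E_Q V$. Monotonicity of the tail removes the averaging.

  For positivity, the same theorem is applied to $Z = u(X)^{1/\alpha}$ with
  $u(x) = \max(0, x^\alpha - D x^\beta)$. As $Z \le X^+$, its constant is at most $C_+$. For large $D$
  the function $u$ is strictly subharmonic for the lower bound $x \mapsto Ax - B$ wherever it is
  positive, so its constant, a multiple of $E[u(\Psi(X)) - A^\alpha u(X)]$, is positive.
\<close>

section \<open>Closed semigroups of reals and supports of measures\<close>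

text \<open>The forcing term g is only known to be integrable. Hence the limit is taken for window
  averages: their defect is G(t + h) - G(t), and it tends to 0 merely because the primitive G of g
  converges. Write X for the positive part of the stationary variable. Its moment of order \<alpha>
  may be infinite, so E[\<Psi>(X)^\<alpha> - (A X)^\<alpha>] cannot be split, and its sign is not
  visible. The estimates use an exponent \<beta> > 0 with \<alpha> - 1 \<le> \<beta> < \<alpha>. By
  strict concavity E A^\<beta> < 1, which gives a finite E X^\<beta> and also the rate b = \<alpha>
  - \<beta>, since E_Q exp(-b V) = E A^\<beta>. The difference of powers is bounded by a constant
  times |B|^\<alpha> + |B|^(\<alpha> - \<beta>) (A X)^\<beta>. The correction -D x^\<beta> in u
  exploits the same gap: the terms x^\<alpha> balance because E A^\<alpha> = 1, while the correction
  gains D (1 - E A^\<beta>) x^\<beta>, which for large D exceeds the error above. Unboundedness of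
  the support enters through u(X) > 0 having positive probability.\<close>

lemma AE_msupp:
  assumes "finite_measure M" and [measurable_cong]: "sets M = sets borel"
  shows "AE x in M. x \<in> msupp M"
proof -
  interpret finite_measure M by fact
  \<comment> \<open>These index null balls with rational centre and radius 1/(n+1). They cover the
    complement of the support: if the ball of radius \<open>e\<close> at \<open>x\<close> is null, a
    rational ball of radius below e/2 contains \<open>x\<close> and stays inside it.\<close>
  define I where "I = {(q, n). q \<in> \<rat> \<and> emeasure M (ball q (1 / Suc n)) = 0}"
  have "countable (\<rat> \<times> (UNIV :: nat set))"
    by (intro countable_SIGMA countable_rat) auto
  then have "countable I"
    by (rule countable_subset[rotated]) (auto simp: I_def)
  then have N: "(\<Union>(q, n)\<in>I. ball q (1 / Suc n)) \<in> null_sets M"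
    by (rule null_sets_UN') (auto simp: I_def null_sets_def assms)
  show ?thesis
  proof (rule AE_I'[OF N], safe)
    fix x assume "x \<notin> msupp M"
    then obtain e where e: "e > 0" "emeasure M (ball x e) = 0"
      by (auto simp: msupp_def not_less)
    obtain n where n: "1 / Suc n < e / 2"
      using nat_approx_posE[of "e/2"] e by auto
    obtain q where q: "q \<in> \<rat>" "x < q" "q < x + 1 / Suc n"
      using Rats_dense_in_real[of x "x + 1 / Suc n"] by auto
    have "ball q (1 / Suc n) \<subseteq> ball x e"
      using q n by (auto simp: dist_real_def)
    then have "emeasure M (ball q (1 / Suc n)) \<le> emeasure M (ball x e)"
      by (intro emeasure_mono) (auto simp: assms)
    with q e have "(q, n) \<in> I" by (simp add: I_def)
    moreover have "x \<in> ball q (1 / Suc n)" using q by (simp add: dist_real_def)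
    ultimately show "x \<in> (\<Union>(q, n)\<in>I. ball q (1 / Suc n))" by blast
  qed
qed

lemma semigroup_of_nat_mult:
  fixes S :: "real set"
  assumes "0 \<in> S" "\<And>x y. x \<in> S \<Longrightarrow> y \<in> S \<Longrightarrow> x + y \<in> S" "s \<in> S"
  shows "real n * s \<in> S"
  by (induction n) (use assms in \<open>auto simp: algebra_simps\<close>)

text \<open>To approximate x, multiples of the negative element \<open>b\<close> lead below x, and
  steps shorter than \<open>e\<close> then climb back until the remainder is less than one step.
  Closedness finishes.\<close>

lemma closed_semigroup_small_steps:
  fixes S :: "real set"
  assumes S: "closed S" "0 \<in> S" "\<And>x y. x \<in> S \<Longrightarrow> y \<in> S \<Longrightarrow> x + y \<in> S"
    and b: "b \<in> S" "b < 0" and small: "\<And>e. e > 0 \<Longrightarrow> \<exists>s\<in>S. 0 < s \<and> s < e"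
  shows "S = UNIV"
proof -
  have "x \<in> S" for x
  proof -
    have "\<exists>y\<in>S. dist y x < e" if e: "e > 0" for e
    proof -
      obtain s where s: "s \<in> S" "0 < s" "s < e" using small[OF e] by auto
      obtain k :: nat where k: "- x / (- b) < real k" using reals_Archimedean2 by blast
      define y where "y = x - k * b"
      have y: "y > 0" using k b by (simp add: y_def field_simps)
      define n where "n = nat \<lfloor>y / s\<rfloor>"
      have "real n = of_int \<lfloor>y / s\<rfloor>" using y s by (simp add: n_def)
      then have "real n \<le> y / s" "y / s < real n + 1" by linarith+
      then have n: "real n * s \<le> y" "y < real n * s + s"
        using s by (auto simp: field_simps)
      have "real n * s + real k * b \<in> S"
        by (intro S(3) semigroup_of_nat_mult S s b)
      moreover have "dist (real n * s + real k * b) x < e"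
        using n s by (auto simp: dist_real_def y_def)
      ultimately show ?thesis by blast
    qed
    then show ?thesis using closed_approachable[OF S(1)] by blast
  qed
  then show ?thesis by blast
qed

text \<open>If \<open>S\<close> is not the whole line, the preceding lemma for \<open>S\<close> and
  for its reflection keeps nonzero elements away from 0. The least positive and the greatest
  negative element are then opposite, and division with remainder places \<open>S\<close> in a
  lattice.\<close>

lemma closed_semigroup_eq_UNIV:
  fixes S :: "real set"
  assumes S: "closed S" "0 \<in> S" "\<And>x y. x \<in> S \<Longrightarrow> y \<in> S \<Longrightarrow> x + y \<in> S"
    and a: "a \<in> S" "a > 0" and b: "b \<in> S" "b < 0"
    and nonarith: "\<not> (\<exists>c>0. S \<subseteq> {c * of_int k | k. True})"
  shows "S = UNIV"
proof (rule ccontr)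
  assume ne: "S \<noteq> UNIV"
  obtain e1 where e1: "e1 > 0" "\<And>s. s \<in> S \<Longrightarrow> 0 < s \<Longrightarrow> e1 \<le> s"
    using closed_semigroup_small_steps[OF S b] ne by (force simp: not_less)
  obtain e2 where e2: "e2 > 0" "\<And>s. s \<in> S \<Longrightarrow> s < 0 \<Longrightarrow> s \<le> - e2"
  proof -
    have "uminus ` S \<noteq> UNIV"
      using ne by (metis bij_uminus bij_is_inj inj_image_eq_iff surj_uminus)
    moreover have "closed (uminus ` S)"
      using S(1) by (rule closed_negations)
    moreover have "0 \<in> uminus ` S" using S(2) by force
    moreover have "x + y \<in> uminus ` S" if "x \<in> uminus ` S" "y \<in> uminus ` S" for x y
    proof -
      from that obtain x' y' where "x = - x'" "y = - y'" "x' \<in> S" "y' \<in> S" by auto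
      then show ?thesis using S(3)[of x' y'] by (intro image_eqI[of _ _ "x' + y'"]) auto
    qed
    moreover have "- a \<in> uminus ` S" using a by auto
    ultimately have "\<not> (\<forall>e>0. \<exists>s\<in>uminus ` S. 0 < s \<and> s < e)"
      using closed_semigroup_small_steps[of "uminus ` S" "- a"] a(2) by (metis neg_less_0_iff_less)
    then obtain e where "e > 0" "\<not> (\<exists>s\<in>uminus ` S. 0 < s \<and> s < e)" by blast
    then have "s \<le> - e" if "s \<in> S" "s < 0" for s using that by force
    with that \<open>e > 0\<close> show ?thesis by blast
  qed
  define d where "d = Inf (S \<inter> {e1..})"
  have cl: "closed (S \<inter> {e1..})" by (intro closed_Int S closed_atLeast)
  have "d \<in> S \<inter> {e1..}" unfolding d_def
    by (rule closed_contains_Inf[OF _ _ cl]) (use a e1 in \<open>auto intro!: bdd_belowI[of _ e1]\<close>)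
  then have d: "d \<in> S" "d > 0" using e1 by auto
  have d_min: "d \<le> s" if "s \<in> S" "s > 0" for s
    unfolding d_def by (rule cInf_lower) (use that e1 in \<open>auto intro!: bdd_belowI[of _ e1]\<close>)
  define d' where "d' = Sup (S \<inter> {..-e2})"
  have cl': "closed (S \<inter> {..-e2})" by (intro closed_Int S closed_atMost)
  have "d' \<in> S \<inter> {..-e2}" unfolding d'_def
    by (rule closed_contains_Sup[OF _ _ cl']) (use b e2 in \<open>auto intro!: bdd_aboveI[of _ "-e2"]\<close>)
  then have d': "d' \<in> S" "d' < 0" using e2 by auto
  have d'_max: "s \<le> d'" if "s \<in> S" "s < 0" for s
    unfolding d'_def by (rule cSup_upper) (use that e2 in \<open>auto intro!: bdd_aboveI[of _ "-e2"]\<close>)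
  have "d + d' \<in> S" using S d d' by blast
  \<comment> \<open>A positive sum would be an element below \<open>d\<close>, a negative one an
    element above \<open>d'\<close>.\<close>
  then have "d + d' = 0" using d_min[of "d + d'"] d'_max[of "d + d'"] d d' by linarith
  then have md: "- d \<in> S" using d' by (simp add: add_eq_0_iff)
  have "s \<in> {d * of_int k | k. True}" if s: "s \<in> S" for s
  proof -
    define k where "k = \<lfloor>s / d\<rfloor>"
    have "of_int k \<le> s / d" "s / d < of_int k + 1" unfolding k_def by linarith+
    then have k: "of_int k * d \<le> s" "s < of_int k * d + d"
      using d by (auto simp: field_simps)
    have "of_int (- k) * d \<in> S"
    proof (cases "k \<le> 0")
      case True
      then show ?thesis using semigroup_of_nat_mult[OF S(2,3) d(1), of "nat (- k)"] by simp
    next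
      case False
      then show ?thesis using semigroup_of_nat_mult[OF S(2,3) md, of "nat k"] by simp
    qed
    then have "s + of_int (- k) * d \<in> S" using S(3) s by blast
    \<comment> \<open>The remainder lies in \<open>S\<close> and in [0, d), so minimality of
      \<open>d\<close> leaves only 0.\<close>
    then have "s + of_int (- k) * d = 0" using d_min[of "s + of_int (- k) * d"] k by force
    then have "s = d * of_int k" by (simp add: algebra_simps)
    then show ?thesis by blast
  qed
  with nonarith d show False by blast
qed

text \<open>\<open>M\<close> is the upper limit at infinity. The eventual bound is kept next to the
  sequence because both are needed later: convergence to \<open>M\<close> along \<open>s\<close>,
  and no values much above \<open>M\<close> near infinity.\<close>

lemma limsup_witness:
  fixes f :: "real \<Rightarrow> real"
  assumes bdd: "\<And>t. \<bar>f t\<bar> \<le> K"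
  obtains M s where "\<And>e. e > 0 \<Longrightarrow> \<forall>\<^sub>F t in at_top. f t \<le> M + e"
    "filterlim s at_top sequentially" "(\<lambda>n. f (s n)) \<longlonglongrightarrow> M"
proof -
  define M where "M = (INF T. SUP t\<in>{T..}. f t)"
  have bdd': "bdd_above (f ` {T..})" for T
    by (rule bdd_aboveI[of _ K]) (use bdd in \<open>auto simp: abs_le_iff\<close>)
  have low: "bdd_below (range (\<lambda>T. SUP t\<in>{T..}. f t))"
  proof (rule bdd_belowI[of _ "-K"], safe)
    fix T
    have "- K \<le> f T" using bdd[of T] by (auto simp: abs_le_iff)
    also have "\<dots> \<le> (SUP t\<in>{T..}. f t)" by (rule cSUP_upper[OF _ bdd']) auto
    finally show "- K \<le> (SUP t\<in>{T..}. f t)" .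
  qed
  have ev: "\<forall>\<^sub>F t in at_top. f t \<le> M + e" if "e > 0" for e
  proof -
    have "M < M + e" using that by simp
    then obtain T where T: "(SUP t\<in>{T..}. f t) < M + e"
      unfolding M_def using low by (subst (asm) cINF_less_iff) auto
    have "f t \<le> M + e" if "t \<ge> T" for t
      using cSUP_upper[OF _ bdd', of t T] T that by force
    then show ?thesis by (auto simp: eventually_at_top_linorder)
  qed
  have ex: "\<exists>t\<ge>real n. M - 1 / Suc n < f t" for n
  proof -
    have "M \<le> (SUP t\<in>{real n..}. f t)" unfolding M_def by (rule cINF_lower[OF low]) simp
    moreover have "M - 1 / Suc n < M" by simp
    ultimately have "M - 1 / Suc n < (SUP t\<in>{real n..}. f t)" by linarith
    then show ?thesis by (subst (asm) less_cSUP_iff[OF _ bdd']) auto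
  qed
  then obtain s where s: "\<And>n. s n \<ge> real n" "\<And>n. M - 1 / Suc n < f (s n)" by metis
  have s_top: "filterlim s at_top sequentially"
    by (rule filterlim_at_top_mono[OF filterlim_real_sequentially]) (use s in auto)
  have "(\<lambda>n. f (s n)) \<longlonglongrightarrow> M"
  proof (rule LIMSEQ_I)
    fix e :: real assume e: "e > 0"
    have "\<forall>\<^sub>F n in sequentially. f (s n) \<le> M + e / 2"
      using filterlim_iff[THEN iffD1, OF s_top] ev[of "e/2"] e by auto
    moreover have "\<forall>\<^sub>F n in sequentially. 1 / Suc n < e"
      using order_tendstoD(2)[OF lim_inverse_n' e] 
      by (rule eventually_sequentially_Suc[THEN iffD2, of "\<lambda>n. 1 / n < e", rotated -1]) 
    ultimately have "\<forall>\<^sub>F n in sequentially. norm (f (s n) - M) < e"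
    proof eventually_elim
      case (elim n)
      then show ?case using s(2)[of n] e unfolding real_norm_def abs_less_iff by linarith
    qed
    then show "\<exists>no. \<forall>n\<ge>no. norm (f (s n) - M) < e" by (simp add: eventually_sequentially)
  qed
  with that ev s_top show ?thesis by blast
qed

section \<open>Lipschitz solutions of the asymptotic renewal equation\<close>

text \<open>Integrating $f(t + y)$ against this kernel gives $\int_{t-v}^t f$ for either sign of $v$.\<close>

definition signed_ivl :: "real \<Rightarrow> real \<Rightarrow> real" where
  "signed_ivl v y = sgn v * indicator {min 0 (- v)<..max 0 (- v)} y"

lemma signed_ivl_measurable [measurable]:
  "case_prod signed_ivl \<in> borel_measurable (borel \<Otimes>\<^sub>M borel)"
proof -
  have "case_prod signed_ivl = (\<lambda>(v, y). sgn v * (if min 0 (- v) < y \<and> y \<le> max 0 (- v) then 1 else 0))"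
    by (auto simp: signed_ivl_def fun_eq_iff)
  then show ?thesis by simp
qed

lemma signed_ivl_measurable' [measurable]: "signed_ivl v \<in> borel_measurable borel"
  unfolding signed_ivl_def by measurable

text \<open>As a difference of two half-lines the kernel matches a difference of two primitives, as
  used in \<open>prim_diff_signed_ivl\<close>.\<close>

lemma signed_ivl_eq: "signed_ivl v y = indicator {..0} y - indicator {..-v} y"
  by (auto simp: signed_ivl_def indicator_def sgn_real_def)

lemma integrable_signed_ivl: "integrable lborel (signed_ivl v)"
  unfolding signed_ivl_def by (auto intro!: integrable_mult_right integrable_real_indicator simp: min_def max_def)

lemma integral_signed_ivl: "(\<integral>y. signed_ivl v y \<partial>lborel) = v"
  unfolding signed_ivl_def by (auto simp: sgn_real_def)

lemma integral_abs_signed_ivl: "(\<integral>y. \<bar>signed_ivl v y\<bar> \<partial>lborel) = \<bar>v\<bar>"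
  unfolding signed_ivl_def abs_mult by (auto simp: sgn_real_def)

text \<open>In the application \<open>V\<close> is ln A under the tilted law. The positive mean and
  \<open>V_neg\<close> give elements of both signs in a closed semigroup containing the support;
  \<open>nonarith\<close> then makes it the whole line.\<close>

locale renewal_walk = prob_space Q for Q :: "'a measure" +
  fixes V :: "'a \<Rightarrow> real"
  assumes V_int: "integrable Q V"
    and mean_pos: "expectation V > 0"
    and V_neg: "\<not> (AE w in Q. 0 \<le> V w)"
    and nonarith: "\<not> (\<exists>c>0. AE w in Q. V w \<in> {c * of_int k | k. True})"
begin

lemma V_meas [measurable]: "V \<in> borel_measurable Q"
  using V_int by (rule borel_measurable_integrable)

lemma V_in_msupp: "AE w in Q. V w \<in> msupp (distr Q borel V)"
proof -
  interpret D: prob_space "distr Q borel V" by (rule prob_space_distr) simp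
  show ?thesis
    by (rule AE_distrD[OF V_meas AE_msupp]) (auto intro: D.finite_measure_axioms)
qed

lemma closed_semigroup_containing_steps:
  assumes S: "closed S" "0 \<in> S" "\<And>x y. x \<in> S \<Longrightarrow> y \<in> S \<Longrightarrow> x + y \<in> S"
    and sub: "msupp (distr Q borel V) \<subseteq> S"
  shows "S = UNIV"
proof -
  have AE: "AE w in Q. V w \<in> S" using V_in_msupp sub by auto
  have "\<exists>a\<in>S. a > 0"
  proof (rule ccontr)
    assume "\<not> (\<exists>a\<in>S. a > 0)"
    then have "AE w in Q. V w \<le> 0" using AE by (auto simp: not_less)
    then have "expectation V \<le> expectation (\<lambda>_. 0)" by (intro integral_mono_AE V_int) auto
    with mean_pos show False by simp
  qed
  moreover have "\<exists>b\<in>S. b < 0"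
  proof (rule ccontr)
    assume "\<not> (\<exists>b\<in>S. b < 0)"
    then have "AE w in Q. 0 \<le> V w" using AE by (auto simp: not_less)
    with V_neg show False by simp
  qed
  moreover have "\<not> (\<exists>c>0. S \<subseteq> {c * of_int k | k. True})"
  proof
    assume "\<exists>c>0. S \<subseteq> {c * of_int k | k. True}"
    then obtain c where c: "c > 0" "S \<subseteq> {c * of_int k | k. True}" by blast
    have "AE w in Q. V w \<in> {c * of_int k | k. True}" using AE c(2) by (auto elim!: eventually_mono)
    with nonarith c(1) show False by blast
  qed
  ultimately show ?thesis using closed_semigroup_eq_UNIV[OF S] by blast
qed

text \<open>\<open>M\<close> is fixed as an asymptotic upper bound, while the sequence realising it
  stays a variable of each lemma, because the argument replaces a sequence by its
  translates.\<close>

context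
  fixes f :: "real \<Rightarrow> real" and K L M :: real
  assumes f_bdd: "\<And>t. \<bar>f t\<bar> \<le> K"
    and f_lip: "\<And>x y. \<bar>f x - f y\<bar> \<le> L * \<bar>x - y\<bar>"
    and f_eq: "((\<lambda>t. f t - expectation (\<lambda>w. f (t - V w))) \<longlongrightarrow> 0) at_top"
    and f_ub: "\<And>e. e > 0 \<Longrightarrow> \<forall>\<^sub>F t in at_top. f t \<le> M + e"
begin

lemma f_meas: "f \<in> borel_measurable borel"
proof (rule borel_measurable_continuous_onI)
  have "0 \<le> L" using f_lip[of 1 0] by simp
  then have "L-lipschitz_on UNIV f" using f_lip by (auto intro!: lipschitz_onI simp: dist_real_def)
  then show "continuous_on UNIV f" by (rule lipschitz_on_continuous_on)
qed

lemma f_comp_int: "integrable Q (\<lambda>w. f (t - V w))"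
  by (rule integrable_const_bound[of _ K]) (use f_bdd f_meas in auto)

text \<open>The values at \<open>s n - V w\<close> do not exceed \<open>M\<close> in the limit, yet
  by \<open>f_eq\<close> their mean tends to \<open>M\<close>. The excess over \<open>M\<close>
  vanishes by dominated convergence, and so the deficit must vanish as well.\<close>

lemma translates_L1:
  assumes s: "filterlim s at_top sequentially" "(\<lambda>n. f (s n)) \<longlonglongrightarrow> M"
  shows "(\<lambda>n. expectation (\<lambda>w. \<bar>M - f (s n - V w)\<bar>)) \<longlonglongrightarrow> 0"
proof -
  note f_meas [measurable]
  note int = f_comp_int
  have neg: "(\<lambda>n. expectation (\<lambda>w. max 0 (f (s n - V w) - M))) \<longlonglongrightarrow> expectation (\<lambda>w. 0)"
  proof (rule integral_dominated_convergence[where w="\<lambda>_. K + \<bar>M\<bar>"])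
    show "AE w in Q. (\<lambda>n. max 0 (f (s n - V w) - M)) \<longlonglongrightarrow> 0"
    proof (rule AE_I2)
      fix w
      have top: "filterlim (\<lambda>n. s n - V w) at_top sequentially"
        using filterlim_tendsto_add_at_top[OF tendsto_const[of "- V w"] s(1)] by simp
      show "(\<lambda>n. max 0 (f (s n - V w) - M)) \<longlonglongrightarrow> 0"
      proof (rule LIMSEQ_I)
        fix e :: real assume e: "e > 0"
        have "\<forall>\<^sub>F n in sequentially. f (s n - V w) \<le> M + e/2"
          using top f_ub[of "e/2"] e unfolding filterlim_iff by auto
        then have "\<forall>\<^sub>F n in sequentially. norm (max 0 (f (s n - V w) - M) - 0) < e"
          by eventually_elim (use e in auto)
        then show "\<exists>no. \<forall>n\<ge>no. norm (max 0 (f (s n - V w) - M) - 0) < e"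
          by (simp add: eventually_sequentially)
      qed
    qed
    show "AE w in Q. norm (max 0 (f (s n - V w) - M)) \<le> K + \<bar>M\<bar>" for n
    proof (rule AE_I2)
      fix w show "norm (max 0 (f (s n - V w) - M)) \<le> K + \<bar>M\<bar>"
        using f_bdd[of "s n - V w"] by (auto simp: max_def)
    qed
  qed auto
  have "(\<lambda>n. (M - f (s n)) + (f (s n) - expectation (\<lambda>w. f (s n - V w)))) \<longlonglongrightarrow> (M - M) + 0"
    by (intro tendsto_add tendsto_diff tendsto_const s filterlim_compose[OF f_eq s(1)])
  then have "(\<lambda>n. (M - expectation (\<lambda>w. f (s n - V w)))
      + 2 * expectation (\<lambda>w. max 0 (f (s n - V w) - M))) \<longlonglongrightarrow> 0 + 2 * 0"
    using neg by (intro tendsto_add tendsto_mult tendsto_const) auto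
  moreover have "(M - expectation (\<lambda>w. f (s n - V w)))
      + 2 * expectation (\<lambda>w. max 0 (f (s n - V w) - M)) = expectation (\<lambda>w. \<bar>M - f (s n - V w)\<bar>)" for n
  proof -
    have "\<bar>M - f (s n - V w)\<bar> = (M - f (s n - V w)) + 2 * max 0 (f (s n - V w) - M)" for w
      by (auto simp: max_def)
    moreover have "integrable Q (\<lambda>w. max 0 (f (s n - V w) - M))"
      using int by (intro integrable_max) auto
    ultimately show ?thesis using int by (simp add: prob_space)
  qed
  ultimately show ?thesis by simp
qed

text \<open>As \<open>v\<close> is in the support, \<open>V\<close> is within \<open>d\<close> of
  \<open>v\<close> with positive probability, and there \<open>f (s n - V w)\<close> differs from
  \<open>f (s n - v)\<close> by at most \<open>L * d\<close>. Convergence in mean therefore forces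
  convergence at \<open>v\<close>.\<close>

lemma translate_by_step:
  assumes s: "filterlim s at_top sequentially" "(\<lambda>n. f (s n)) \<longlonglongrightarrow> M"
    and v: "v \<in> msupp (distr Q borel V)"
  shows "(\<lambda>n. f (s n - v)) \<longlonglongrightarrow> M"
proof (rule LIMSEQ_I)
  fix e :: real assume e: "e > 0"
  have L: "0 \<le> L" using f_lip[of 1 0] by simp
  \<comment> \<open>The \<open>+ 1\<close> keeps the denominator positive when \<open>L = 0\<close>
    and still leaves \<open>L * d < e / 2\<close>.\<close>
  define d where "d = e / (2 * (L + 1))"
  have d: "d > 0" "L * d < e / 2" using e L by (auto simp: d_def field_simps)
  define E where "E = V -` ball v d \<inter> space Q"
  have E [measurable]: "E \<in> events" unfolding E_def by measurable
  have "emeasure (distr Q borel V) (ball v d) > 0" using v d by (auto simp: msupp_def)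
  then have q: "prob E > 0" by (simp add: E_def emeasure_distr emeasure_eq_measure)
  have int: "integrable Q (\<lambda>w. \<bar>M - f (s n - V w)\<bar>)" for n
    by (intro integrable_abs Bochner_Integration.integrable_diff f_comp_int integrable_const)
  have bound: "prob E * (\<bar>f (s n - v) - M\<bar> - L * d) \<le> expectation (\<lambda>w. \<bar>M - f (s n - V w)\<bar>)" for n
  proof -
    have "prob E * (\<bar>f (s n - v) - M\<bar> - L * d) = expectation (\<lambda>w. indicator E w * (\<bar>f (s n - v) - M\<bar> - L * d))"
      by simp
    also have "\<dots> \<le> expectation (\<lambda>w. \<bar>M - f (s n - V w)\<bar>)"
    proof (rule integral_mono[OF _ int])
      show "integrable Q (\<lambda>w. indicator E w * (\<bar>f (s n - v) - M\<bar> - L * d))"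
        by (intro integrable_mult_left integrable_real_indicator) (auto simp: emeasure_eq_measure)
      fix w
      have "w \<in> E \<Longrightarrow> \<bar>f (s n - v) - f (s n - V w)\<bar> \<le> L * d"
        using f_lip[of "s n - v" "s n - V w"] mult_left_mono[OF _ L, of "\<bar>V w - v\<bar>" d]
        by (auto simp: E_def dist_real_def abs_minus_commute)
      then show "indicator E w * (\<bar>f (s n - v) - M\<bar> - L * d) \<le> \<bar>M - f (s n - V w)\<bar>"
        by (cases "w \<in> E") auto
    qed
    finally show ?thesis .
  qed
  have "\<forall>\<^sub>F n in sequentially. expectation (\<lambda>w. \<bar>M - f (s n - V w)\<bar>) < prob E * (e / 2)"
    using order_tendstoD(2)[OF translates_L1[OF s], of "prob E * (e / 2)"] q e by simp
  then have "\<forall>\<^sub>F n in sequentially. norm (f (s n - v) - M) < e"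
  proof eventually_elim
    case (elim n)
    then have "prob E * (\<bar>f (s n - v) - M\<bar> - L * d) < prob E * (e / 2)" using bound[of n] by linarith
    then show ?case using q d by simp
  qed
  then show "\<exists>no. \<forall>n\<ge>no. norm (f (s n - v) - M) < e" by (simp add: eventually_sequentially)
qed

text \<open>Admissible shifts are those preserving every sequence that realises \<open>M\<close>.
  The quantifier over all sequences makes them a semigroup, the Lipschitz bound makes them closed,
  and they contain the support of \<open>V\<close>.\<close>

lemma translates_converge:
  assumes s: "filterlim s at_top sequentially" "(\<lambda>n. f (s n)) \<longlonglongrightarrow> M"
  shows "(\<lambda>n. f (s n - x)) \<longlonglongrightarrow> M"
proof -
  define good where "good u \<longleftrightarrow> filterlim u at_top sequentially \<and> (\<lambda>n. f (u n)) \<longlonglongrightarrow> M" for u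
  define S where "S = {x. \<forall>u. good u \<longrightarrow> good (\<lambda>n. u n - x)}"
  have top: "filterlim (\<lambda>n. u n - x) at_top sequentially"
    if "filterlim u at_top sequentially" for u :: "nat \<Rightarrow> real" and x
    using filterlim_tendsto_add_at_top[OF tendsto_const[of "- x"] that] by simp
  have "S = UNIV"
  proof (rule closed_semigroup_containing_steps)
    show "0 \<in> S" by (simp add: S_def)
    show "x + y \<in> S" if "x \<in> S" "y \<in> S" for x y
      using that unfolding S_def by (force simp: diff_diff_eq[symmetric])
    show "msupp (distr Q borel V) \<subseteq> S"
      using translate_by_step top by (auto simp: S_def good_def)
    have L: "0 \<le> L" using f_lip[of 1 0] by simp
    show "closed S"
      unfolding closed_sequential_limits
    proof safe
      fix X l assume X: "\<forall>n. X n \<in> S" "X \<longlonglongrightarrow> l"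
      show "l \<in> S"
        unfolding S_def
      proof safe
        fix u assume u: "good u"
        have "(\<lambda>n. f (u n - l)) \<longlonglongrightarrow> M"
        proof (rule LIMSEQ_I)
          fix e :: real assume e: "e > 0"
          have "\<forall>\<^sub>F k in sequentially. dist (X k) l < e / (2 * (L + 1))"
            using tendstoD[OF X(2), of "e / (2 * (L + 1))"] e L by auto
          then obtain k where k: "\<bar>X k - l\<bar> < e / (2 * (L + 1))"
            unfolding eventually_sequentially dist_real_def by blast
          then have "L * \<bar>X k - l\<bar> \<le> L * (e / (2 * (L + 1)))" using L by (intro mult_left_mono) auto
          also have "\<dots> < e / 2" using L e by (simp add: field_simps)
          finally have k': "L * \<bar>X k - l\<bar> < e / 2" .
          have "(\<lambda>n. f (u n - X k)) \<longlonglongrightarrow> M" using X(1) u by (auto simp: S_def good_def)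
          then have "\<forall>\<^sub>F n in sequentially. \<bar>f (u n - X k) - M\<bar> < e / 2"
            using tendstoD[of _ M sequentially "e/2"] e by (auto simp: dist_real_def)
          then have "\<forall>\<^sub>F n in sequentially. norm (f (u n - l) - M) < e"
          proof eventually_elim
            case (elim n)
            have "\<bar>f (u n - l) - f (u n - X k)\<bar> \<le> L * \<bar>X k - l\<bar>"
              using f_lip[of "u n - l" "u n - X k"] by simp
            with elim k' show ?case unfolding real_norm_def by linarith
          qed
          then show "\<exists>no. \<forall>n\<ge>no. norm (f (u n - l) - M) < e" by (simp add: eventually_sequentially)
        qed
        with u top show "good (\<lambda>n. u n - l)" by (auto simp: good_def)
      qed
    qed
  qed
  then have "x \<in> S" by simp
  with s show ?thesis by (auto simp: S_def good_def)
qed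

text \<open>By \<open>translates_converge\<close>, \<open>f (s n + y)\<close> tends to
  \<open>M\<close> for every \<open>y\<close>. Two dominated convergences, in \<open>y\<close> and
  then in \<open>w\<close> with bound \<open>K * |V w|\<close>, turn the limit into
  \<open>M * expectation V\<close>.\<close>

lemma limsup_value:
  assumes s: "filterlim s at_top sequentially" "(\<lambda>n. f (s n)) \<longlonglongrightarrow> M"
    and lim: "((\<lambda>t. expectation (\<lambda>w. \<integral>y. f (t + y) * signed_ivl (V w) y \<partial>lborel)) \<longlongrightarrow> \<Lambda>) at_top"
  shows "M = \<Lambda> / expectation V"
proof -
  note f_meas [measurable]
  have bd: "\<bar>f x * signed_ivl v y\<bar> \<le> K * \<bar>signed_ivl v y\<bar>" for x v y
    unfolding abs_mult using f_bdd by (intro mult_right_mono) auto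
  have intK: "integrable lborel (\<lambda>y. K * \<bar>signed_ivl v y\<bar>)" for v
    using integrable_signed_ivl by auto
  have int: "integrable lborel (\<lambda>y. f (t + y) * signed_ivl v y)" for t v
    by (rule Bochner_Integration.integrable_bound[OF intK[of v]])
      (auto intro!: AE_I2 order_trans[OF bd abs_ge_self])
  have "(\<lambda>n. expectation (\<lambda>w. \<integral>y. f (s n + y) * signed_ivl (V w) y \<partial>lborel)) \<longlonglongrightarrow> expectation (\<lambda>w. M * V w)"
  proof (rule integral_dominated_convergence[where w="\<lambda>w. K * \<bar>V w\<bar>"])
    show "AE w in Q. (\<lambda>n. \<integral>y. f (s n + y) * signed_ivl (V w) y \<partial>lborel) \<longlonglongrightarrow> M * V w"
    proof (rule AE_I2)
      fix w
      have "(\<lambda>n. \<integral>y. f (s n + y) * signed_ivl (V w) y \<partial>lborel) \<longlonglongrightarrow> (\<integral>y. M * signed_ivl (V w) y \<partial>lborel)"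
      proof (rule integral_dominated_convergence[OF _ _ intK[of "V w"]])
        have "(\<lambda>n. f (s n + y) * signed_ivl (V w) y) \<longlonglongrightarrow> M * signed_ivl (V w) y" for y
          using translates_converge[OF s, of "- y"] by (intro tendsto_mult) auto
        then show "AE y in lborel. (\<lambda>n. f (s n + y) * signed_ivl (V w) y) \<longlonglongrightarrow> M * signed_ivl (V w) y"
          by auto
      qed (use bd in \<open>auto intro!: AE_I2 simp: abs_mult\<close>)
      then show "(\<lambda>n. \<integral>y. f (s n + y) * signed_ivl (V w) y \<partial>lborel) \<longlonglongrightarrow> M * V w"
        by (simp add: integral_signed_ivl)
    qed
    show "AE w in Q. norm (\<integral>y. f (s n + y) * signed_ivl (V w) y \<partial>lborel) \<le> K * \<bar>V w\<bar>" for n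
    proof (rule AE_I2)
      fix w
      have "norm (\<integral>y. f (s n + y) * signed_ivl (V w) y \<partial>lborel) \<le> (\<integral>y. K * \<bar>signed_ivl (V w) y\<bar> \<partial>lborel)"
        using bd by (intro Bochner_Integration.integral_norm_bound_integral int intK) auto
      then show "norm (\<integral>y. f (s n + y) * signed_ivl (V w) y \<partial>lborel) \<le> K * \<bar>V w\<bar>"
        by (simp add: integral_abs_signed_ivl)
    qed
  qed (use V_int in auto)
  moreover have "(\<lambda>n. expectation (\<lambda>w. \<integral>y. f (s n + y) * signed_ivl (V w) y \<partial>lborel)) \<longlonglongrightarrow> \<Lambda>"
    by (rule filterlim_compose[OF lim s(1)])
  ultimately have "expectation (\<lambda>w. M * V w) = \<Lambda>" by (rule LIMSEQ_unique)
  then have "M * expectation V = \<Lambda>" by simp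
  with mean_pos show ?thesis by (simp add: field_simps)
qed

end

lemma eventually_le_renewal_value:
  fixes f :: "real \<Rightarrow> real"
  assumes "\<And>t. \<bar>f t\<bar> \<le> K" "\<And>x y. \<bar>f x - f y\<bar> \<le> L * \<bar>x - y\<bar>"
    and "((\<lambda>t. f t - expectation (\<lambda>w. f (t - V w))) \<longlongrightarrow> 0) at_top"
    and "((\<lambda>t. expectation (\<lambda>w. \<integral>y. f (t + y) * signed_ivl (V w) y \<partial>lborel)) \<longlongrightarrow> \<Lambda>) at_top"
    and "e > 0"
  shows "\<forall>\<^sub>F t in at_top. f t \<le> \<Lambda> / expectation V + e"
proof -
  obtain M s where M: "\<And>e. e > 0 \<Longrightarrow> \<forall>\<^sub>F t in at_top. f t \<le> M + e"
    and s: "filterlim s at_top sequentially" "(\<lambda>n. f (s n)) \<longlonglongrightarrow> M"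
    using limsup_witness[of f K, OF assms(1)] by (metis (no_types))
  have "M = \<Lambda> / expectation V"
    by (rule limsup_value[where f=f, OF assms(1-3) M s assms(4)])
  with M[OF assms(5)] show ?thesis by simp
qed

proposition renewal_limit_lipschitz:
  fixes f :: "real \<Rightarrow> real"
  assumes f: "\<And>t. \<bar>f t\<bar> \<le> K" "\<And>x y. \<bar>f x - f y\<bar> \<le> L * \<bar>x - y\<bar>"
    and eq: "((\<lambda>t. f t - expectation (\<lambda>w. f (t - V w))) \<longlongrightarrow> 0) at_top"
    and lim: "((\<lambda>t. expectation (\<lambda>w. \<integral>y. f (t + y) * signed_ivl (V w) y \<partial>lborel)) \<longlongrightarrow> \<Lambda>) at_top"
  shows "(f \<longlongrightarrow> \<Lambda> / expectation V) at_top"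
proof (rule tendstoI)
  fix e :: real assume e: "e > 0"
  have 1: "\<forall>\<^sub>F t in at_top. f t \<le> \<Lambda> / expectation V + e / 2"
    by (rule eventually_le_renewal_value[OF f eq lim]) (use e in simp)
  \<comment> \<open>The lower limit of \<open>f\<close> is minus the upper limit of
    \<open>- f\<close>, which satisfies the same hypotheses with \<open>- \<Lambda>\<close>.\<close>
  have 2: "\<forall>\<^sub>F t in at_top. - f t \<le> (- \<Lambda>) / expectation V + e / 2"
  proof (rule eventually_le_renewal_value)
    show "\<bar>- f t\<bar> \<le> K" for t using f(1) by simp
    show "\<bar>- f x - - f y\<bar> \<le> L * \<bar>x - y\<bar>" for x y using f(2)[of x y] by (simp add: abs_minus_commute)
    show "((\<lambda>t. - f t - expectation (\<lambda>w. - f (t - V w))) \<longlongrightarrow> 0) at_top"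
      using tendsto_minus[OF eq] by simp
    show "((\<lambda>t. expectation (\<lambda>w. \<integral>y. - f (t + y) * signed_ivl (V w) y \<partial>lborel)) \<longlongrightarrow> - \<Lambda>) at_top"
      using tendsto_minus[OF lim] by simp
  qed (use e in simp)
  from 1 2 show "\<forall>\<^sub>F t in at_top. dist (f t) (\<Lambda> / expectation V) < e"
    by eventually_elim (use e in \<open>auto simp: dist_real_def abs_less_iff\<close>)
qed

end

section \<open>Integrated renewal equations\<close>

lemma (in pair_sigma_finite) pair_integral_mult:
  fixes f :: "'a \<Rightarrow> real" and g :: "'b \<Rightarrow> real"
  assumes [measurable]: "integrable M1 f" "integrable M2 g"
  shows integrable_pair_mult: "integrable (M1 \<Otimes>\<^sub>M M2) (\<lambda>(x, y). f x * g y)"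
    and integral_pair_mult: "(\<integral>(x, y). f x * g y \<partial>(M1 \<Otimes>\<^sub>M M2)) = (\<integral>x. f x \<partial>M1) * (\<integral>y. g y \<partial>M2)"
proof -
  show int: "integrable (M1 \<Otimes>\<^sub>M M2) (\<lambda>(x, y). f x * g y)"
    by (rule Fubini_integrable) (use assms in \<open>auto simp: abs_mult intro!: integrable_mult_left integrable_mult_right\<close>)
  show "(\<integral>(x, y). f x * g y \<partial>(M1 \<Otimes>\<^sub>M M2)) = (\<integral>x. f x \<partial>M1) * (\<integral>y. g y \<partial>M2)"
    using integral_fst'[OF int] by simp
qed

lemma abs_integral_le:
  fixes f g :: "'a \<Rightarrow> real"
  assumes "integrable M f" "integrable M g" "\<And>x. x \<in> space M \<Longrightarrow> \<bar>f x\<bar> \<le> g x"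
  shows "\<bar>\<integral>x. f x \<partial>M\<bar> \<le> (\<integral>x. g x \<partial>M)"
proof -
  have "\<bar>\<integral>x. f x \<partial>M\<bar> \<le> (\<integral>x. \<bar>f x\<bar> \<partial>M)" by simp
  also have "\<dots> \<le> (\<integral>x. g x \<partial>M)" using assms by (intro integral_mono) auto
  finally show ?thesis .
qed

lemma has_bochner_integral_exp_atMost:
  fixes b t :: real
  assumes b: "b > 0"
  shows "has_bochner_integral lborel (\<lambda>s. indicator {..t} s * exp (b * s)) (exp (b * t) / b)"
proof -
  \<comment> \<open>The substitution is s = t - x / b, from the integral of exp(-x) over the
    positive half-line.\<close>
  have "has_bochner_integral lborel (\<lambda>x. exp (b * t) * (exp (- x) * indicator {0..} x)) (exp (b * t) * 1)"
    using has_bochner_integral_mult_right[OF has_bochner_integral_I0i_power_exp_m'[of 0], of "exp (b * t)"] by simp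
  moreover have "exp (b * t) * (exp (- x) * indicator {0..} x) =
      indicator {..t} (t + (- 1 / b) * x) * exp (b * (t + (- 1 / b) * x))" for x
    using b by (auto simp: indicator_def field_simps exp_add[symmetric])
  ultimately have "has_bochner_integral lborel
      (\<lambda>x. indicator {..t} (t + (- 1 / b) * x) * exp (b * (t + (- 1 / b) * x))) ((exp (b * t) / b) /\<^sub>R \<bar>- 1 / b\<bar>)"
    using b by simp
  then show ?thesis
    using b lborel_has_bochner_integral_real_affine_iff[where c = "- 1 / b" and t = t
        and f = "\<lambda>s. indicator {..t} s * exp (b * s)" and x = "exp (b * t) / b"] by simp
qed

lemmas integrable_exp_atMost = has_bochner_integral_exp_atMost[THEN integrable.intros]
lemmas integral_exp_atMost = has_bochner_integral_exp_atMost[THEN has_bochner_integral_integral_eq]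

lemma integral_lborel_shift:
  fixes f :: "real \<Rightarrow> real"
  shows "(\<integral>x. f (x + c) \<partial>lborel) = (\<integral>x. f x \<partial>lborel)"
  using lborel_integral_real_affine[of 1 f c] by (simp add: add.commute)

lemma tendsto_integral_atMost:
  fixes g :: "real \<Rightarrow> real"
  assumes "integrable lborel g"
  shows "((\<lambda>t. \<integral>s. indicator {..t} s * g s \<partial>lborel) \<longlongrightarrow> (\<integral>s. g s \<partial>lborel)) at_top"
proof (rule integral_dominated_convergence_at_top[where w="\<lambda>s. \<bar>g s\<bar>"])
  show "AE s in lborel. ((\<lambda>t. indicator {..t} s * g s) \<longlongrightarrow> g s) at_top"
  proof (rule AE_I2)
    fix s :: real
    have "\<forall>\<^sub>F t in at_top. indicator {..t} s * g s = g s"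
      using eventually_ge_at_top[of s] by eventually_elim simp
    then show "((\<lambda>t. indicator {..t} s * g s) \<longlongrightarrow> g s) at_top" by (rule tendsto_eventually)
  qed
qed (use assms in \<open>auto simp: indicator_def intro!: eventuallyI\<close>)

lemma tendsto_window_integral:
  fixes G :: "real \<Rightarrow> real"
  assumes [measurable]: "G \<in> borel_measurable borel" and h: "h > 0"
    and bdd: "\<And>t. \<bar>G t\<bar> \<le> B" and lim: "(G \<longlongrightarrow> l) at_top"
  shows "((\<lambda>t. \<integral>s. indicator {t<..t + h} s * G s \<partial>lborel) \<longlongrightarrow> h * l) at_top"
proof -
  have "(\<integral>s. indicator {t<..t + h} s * G s \<partial>lborel) = (\<integral>y. indicator {0<..h} y * G (y + t) \<partial>lborel)" for t
    by (subst integral_lborel_shift[of _ t, symmetric]) (auto intro!: Bochner_Integration.integral_cong simp: indicator_def)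
  moreover have "((\<lambda>t. \<integral>y. indicator {0<..h} y * G (y + t) \<partial>lborel) \<longlongrightarrow> (\<integral>y. indicator {0<..h} y * l \<partial>lborel)) at_top"
  proof (rule integral_dominated_convergence_at_top[where w="\<lambda>y. indicator {0<..h} y * B"])
    have "((\<lambda>t. G (y + t)) \<longlongrightarrow> l) at_top" for y
      by (rule filterlim_compose[OF lim filterlim_tendsto_add_at_top[OF tendsto_const filterlim_ident]])
    then show "AE y in lborel. ((\<lambda>t. indicator {0<..h} y * G (y + t)) \<longlongrightarrow> indicator {0<..h} y * l) at_top"
      by (intro AE_I2 tendsto_mult tendsto_const)
    show "\<forall>\<^sub>F t in at_top. AE y in lborel. norm (indicator {0<..h} y * G (y + t)) \<le> indicator {0<..h} y * B"
      using bdd by (intro eventuallyI AE_I2) (auto simp: indicator_def)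
  qed (use h in \<open>auto intro!: integrable_mult_left\<close>)
  ultimately show ?thesis using h by simp
qed

text \<open>Averaging over a step contracts functions of growth \<open>exp (b * t)\<close> by a
  factor below 1. In the application \<open>b = a - p\<close>, and tilting turns the exponential
  moment into the moment of \<open>A\<close> of order \<open>p\<close>.\<close>

locale renewal_walk_exp = renewal_walk +
  fixes b :: real
  assumes b_pos: "b > 0"
    and exp_int: "integrable Q (\<lambda>w. exp (- b * V w))"
    and exp_lt_1: "expectation (\<lambda>w. exp (- b * V w)) < 1"
begin

sublocale QL: pair_sigma_finite Q lborel ..

definition \<rho> :: real where "\<rho> = expectation (\<lambda>w. exp (- b * V w))"

lemma rho: "0 \<le> \<rho>" "\<rho> < 1"
  using exp_lt_1 by (auto simp: \<rho>_def)

lemma exp_shift: "exp (b * (t - V w)) = exp (b * t) * exp (- b * V w)"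
  by (simp add: exp_add[symmetric] algebra_simps)

lemma integrable_shift:
  fixes \<phi> :: "real \<Rightarrow> real"
  assumes [measurable]: "\<phi> \<in> borel_measurable borel" and "\<And>t. \<bar>\<phi> t\<bar> \<le> C * exp (b * t)"
  shows "integrable Q (\<lambda>w. \<phi> (t - V w))"
proof (rule Bochner_Integration.integrable_bound)
  show "integrable Q (\<lambda>w. C * (exp (b * t) * exp (- b * V w)))"
    by (intro integrable_mult_right exp_int)
  show "AE w in Q. norm (\<phi> (t - V w)) \<le> norm (C * (exp (b * t) * exp (- b * V w)))"
    using order_trans[OF assms(2) abs_ge_self] unfolding exp_shift[symmetric] by (intro AE_I2) simp
qed simp

lemma expectation_shift_bound:
  fixes \<phi> :: "real \<Rightarrow> real"
  assumes "\<phi> \<in> borel_measurable borel" "\<And>t. \<bar>\<phi> t\<bar> \<le> C * exp (b * t)"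
  shows "\<bar>expectation (\<lambda>w. \<phi> (t - V w))\<bar> \<le> C * \<rho> * exp (b * t)"
proof -
  have "\<bar>expectation (\<lambda>w. \<phi> (t - V w))\<bar> \<le> expectation (\<lambda>w. C * (exp (b * t) * exp (- b * V w)))"
  proof (rule abs_integral_le[OF integrable_shift[OF assms]])
    show "integrable Q (\<lambda>w. C * (exp (b * t) * exp (- b * V w)))"
      by (intro integrable_mult_right exp_int)
    show "\<bar>\<phi> (t - V w)\<bar> \<le> C * (exp (b * t) * exp (- b * V w))" for w
      using assms(2) by (metis exp_shift)
  qed
  then show ?thesis by (simp add: \<rho>_def mult_ac)
qed

text \<open>The base point is minus infinity, so that taking primitives commutes with translations;
  a bound by a multiple of \<open>exp (b * t)\<close> makes the integral converge.\<close>

definition prim :: "(real \<Rightarrow> real) \<Rightarrow> real \<Rightarrow> real" where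
  "prim \<phi> t = (\<integral>s. indicator {..t} s * \<phi> s \<partial>lborel)"

lemma prim_meas [measurable]: "\<phi> \<in> borel_measurable borel \<Longrightarrow> prim \<phi> \<in> borel_measurable borel"
  unfolding prim_def indicator_def by (simp add: atMost_def)

context
  fixes \<phi> :: "real \<Rightarrow> real" and C :: real
  assumes \<phi>_meas [measurable]: "\<phi> \<in> borel_measurable borel"
    and \<phi>_le: "\<And>t. \<bar>\<phi> t\<bar> \<le> C * exp (b * t)"
begin

lemma prim_integrable: "integrable lborel (\<lambda>s. indicator {..t} s * \<phi> s)"
proof (rule Bochner_Integration.integrable_bound)
  show "integrable lborel (\<lambda>s. C * (indicator {..t} s * exp (b * s)))"
    by (intro integrable_mult_right integrable_exp_atMost b_pos)
qed (use \<phi>_le in \<open>auto intro!: AE_I2 intro: order_trans[OF _ abs_ge_self] simp: indicator_def\<close>)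

lemma prim_bound: "\<bar>prim \<phi> t\<bar> \<le> C / b * exp (b * t)"
proof -
  have "\<bar>prim \<phi> t\<bar> \<le> (\<integral>s. C * (indicator {..t} s * exp (b * s)) \<partial>lborel)"
    unfolding prim_def
    by (rule abs_integral_le) (use \<phi>_le prim_integrable integrable_exp_atMost[OF b_pos] in \<open>auto simp: indicator_def\<close>)
  then show ?thesis by (simp add: integral_exp_atMost b_pos)
qed

lemma prim_diff:
  assumes "x \<le> y"
  shows "prim \<phi> y - prim \<phi> x = (\<integral>s. indicator {x<..y} s * \<phi> s \<partial>lborel)"
proof -
  have "prim \<phi> y - prim \<phi> x = (\<integral>s. indicator {..y} s * \<phi> s - indicator {..x} s * \<phi> s \<partial>lborel)"
    unfolding prim_def by (rule Bochner_Integration.integral_diff[symmetric]) (rule prim_integrable)+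
  also have "\<dots> = (\<integral>s. indicator {x<..y} s * \<phi> s \<partial>lborel)"
    using assms by (intro Bochner_Integration.integral_cong) (auto simp: indicator_def)
  finally show ?thesis .
qed

lemma prim_diff_signed_ivl:
  "prim \<phi> t - prim \<phi> (t - v) = (\<integral>y. \<phi> (t + y) * signed_ivl v y \<partial>lborel)"
proof -
  have "prim \<phi> t - prim \<phi> (t - v) = (\<integral>s. indicator {..t} s * \<phi> s - indicator {..t - v} s * \<phi> s \<partial>lborel)"
    unfolding prim_def by (rule Bochner_Integration.integral_diff[symmetric]) (rule prim_integrable)+
  also have "\<dots> = (\<integral>y. indicator {..t} (y + t) * \<phi> (y + t) - indicator {..t - v} (y + t) * \<phi> (y + t) \<partial>lborel)"
    by (rule integral_lborel_shift[symmetric])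
  also have "\<dots> = (\<integral>y. \<phi> (t + y) * signed_ivl v y \<partial>lborel)"
    by (intro Bochner_Integration.integral_cong) (auto simp: signed_ivl_eq indicator_def add.commute)
  finally show ?thesis .
qed

text \<open>Fubini applies because the integrand is dominated by a multiple of
  \<open>exp (- b * V w) * exp (b * s)\<close> on s \<le> t, a product of integrable
  functions.\<close>

lemma prim_expectation:
  "prim (\<lambda>t. expectation (\<lambda>w. \<phi> (t - V w))) t = expectation (\<lambda>w. prim \<phi> (t - V w))"
proof -
  have "integrable (Q \<Otimes>\<^sub>M lborel) (\<lambda>(w, s). exp (- b * V w) * (indicator {..t} s * exp (b * s)))"
    by (intro QL.integrable_pair_mult exp_int integrable_exp_atMost b_pos)
  then have "integrable (Q \<Otimes>\<^sub>M lborel) (\<lambda>x. C * (case x of (w, s) \<Rightarrow> exp (- b * V w) * (indicator {..t} s * exp (b * s))))"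
    by (rule integrable_mult_right)
  then have int: "integrable (Q \<Otimes>\<^sub>M lborel) (\<lambda>(w, s). indicator {..t} s * \<phi> (s - V w))"
  proof (rule Bochner_Integration.integrable_bound)
    show "AE x in Q \<Otimes>\<^sub>M lborel. norm (case x of (w, s) \<Rightarrow> indicator {..t} s * \<phi> (s - V w))
        \<le> norm (C * (case x of (w, s) \<Rightarrow> exp (- b * V w) * (indicator {..t} s * exp (b * s))))"
    proof (rule AE_I2, clarify)
      fix w and s :: real
      show "norm (indicator {..t} s * \<phi> (s - V w)) \<le> norm (C * (exp (- b * V w) * (indicator {..t} s * exp (b * s))))"
        using order_trans[OF \<phi>_le[of "s - V w"] abs_ge_self]
        by (simp add: indicator_def exp_shift mult_ac)
    qed
  qed measurable
  have "prim (\<lambda>t. expectation (\<lambda>w. \<phi> (t - V w))) t = (\<integral>s. expectation (\<lambda>w. indicator {..t} s * \<phi> (s - V w)) \<partial>lborel)"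
    by (simp add: prim_def)
  also have "\<dots> = expectation (\<lambda>w. \<integral>s. indicator {..t} s * \<phi> (s - V w) \<partial>lborel)"
    by (rule QL.Fubini_integral) (use int in simp)
  also have "\<dots> = expectation (\<lambda>w. prim \<phi> (t - V w))"
  proof (rule Bochner_Integration.integral_cong[OF refl])
    fix w
    show "(\<integral>s. indicator {..t} s * \<phi> (s - V w) \<partial>lborel) = prim \<phi> (t - V w)"
      unfolding prim_def
      by (subst integral_lborel_shift[of _ "V w", symmetric])
         (auto intro!: Bochner_Integration.integral_cong simp: indicator_def)
  qed
  finally show ?thesis .
qed

text \<open>This is used at two levels: it passes from the equation for \<open>r\<close> to the one
  for its primitive, and from the equation for window averages to the identity that determines their
  limit.\<close>

lemma prim_eq: "prim (\<lambda>t. \<phi> t - expectation (\<lambda>w. \<phi> (t - V w))) t = prim \<phi> t - expectation (\<lambda>w. prim \<phi> (t - V w))"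
proof -
  have m: "(\<lambda>t. expectation (\<lambda>w. \<phi> (t - V w))) \<in> borel_measurable borel" by measurable
  have int: "integrable lborel (\<lambda>s. indicator {..t} s * expectation (\<lambda>w. \<phi> (s - V w)))"
  proof (rule Bochner_Integration.integrable_bound)
    show "integrable lborel (\<lambda>s. C * \<rho> * (indicator {..t} s * exp (b * s)))"
      by (intro integrable_mult_right integrable_exp_atMost b_pos)
  qed (use m expectation_shift_bound[OF \<phi>_meas \<phi>_le] in
      \<open>auto intro!: AE_I2 intro: order_trans[OF _ abs_ge_self] simp: indicator_def\<close>)
  show ?thesis
    unfolding prim_expectation[symmetric] unfolding prim_def
    using prim_integrable int by (simp add: right_diff_distrib)
qed

end

end

section \<open>The renewal theorem for scaled tails\<close>

text \<open>Here \<open>r_le\<close> is only an a priori growth bound, and \<open>r_decay\<close>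
  expresses that \<open>exp (- a * t) * r t\<close> decreases, as it does for a scaled tail. The
  term \<open>g\<close> may change sign.\<close>

locale renewal_equation = renewal_walk_exp +
  fixes r g :: "real \<Rightarrow> real" and C a :: real
  assumes r_meas [measurable]: "r \<in> borel_measurable borel"
    and r_nonneg: "\<And>t. 0 \<le> r t"
    and r_le: "\<And>t. r t \<le> C * exp (b * t)"
    and a_nonneg: "0 \<le> a"
    and r_decay: "\<And>s t. s \<le> t \<Longrightarrow> r t \<le> exp (a * (t - s)) * r s"
    and g_int: "integrable lborel g"
    and r_eq: "\<And>t. r t = g t + expectation (\<lambda>w. r (t - V w))"
begin

lemma g_meas [measurable]: "g \<in> borel_measurable borel"
  using borel_measurable_integrable[OF g_int] by simp

lemma r_abs_le: "\<bar>r t\<bar> \<le> C * exp (b * t)"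
  using r_nonneg r_le by simp

lemma C_nonneg: "0 \<le> C"
  using order_trans[OF r_nonneg r_le, of 0] by simp

section \<open>A barrier that bounds the window averages\<close>

definition barrier :: "real \<Rightarrow> real" where
  "barrier x = exp b / (1 - \<rho>) * min 1 (exp (b * x))"

lemma barrier_meas [measurable]: "barrier \<in> borel_measurable borel"
  unfolding barrier_def by measurable

lemma barrier_bounds: "0 \<le> barrier x" "barrier x \<le> exp b / (1 - \<rho>)" "barrier x \<le> exp b / (1 - \<rho>) * exp (b * x)"
proof -
  have "0 \<le> exp b / (1 - \<rho>)" using rho by simp
  then show "0 \<le> barrier x" "barrier x \<le> exp b / (1 - \<rho>)" "barrier x \<le> exp b / (1 - \<rho>) * exp (b * x)"
    unfolding barrier_def by (intro mult_nonneg_nonneg mult_left_le mult_left_mono; simp)+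
qed

text \<open>The factor in \<open>barrier\<close> is dictated by the case x \<le> 0: the surplus
  \<open>\<kappa> * (1 - \<rho>) * exp (b * x)\<close> becomes \<open>exp (b * (1 + x))\<close>,
  which is at least 1 on [-1, 0]. For x > 0 the barrier already has its maximal value.\<close>

lemma barrier_supersolution:
  "indicator {-1..0} x + expectation (\<lambda>u. barrier (x - V u)) \<le> barrier x"
proof -
  define \<kappa> where "\<kappa> = exp b / (1 - \<rho>)"
  have \<kappa>: "\<kappa> > 0" "\<kappa> * (1 - \<rho>) = exp b" using rho by (auto simp: \<kappa>_def)
  have "\<bar>expectation (\<lambda>u. barrier (x - V u))\<bar> \<le> \<kappa> * \<rho> * exp (b * x)"
    by (rule expectation_shift_bound) (use barrier_bounds in \<open>auto simp: \<kappa>_def\<close>)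
  moreover have "expectation (\<lambda>u. barrier (x - V u)) \<le> expectation (\<lambda>_. \<kappa>)"
    by (rule integral_mono[OF integrable_const_bound[of _ \<kappa>]])
       (use barrier_bounds in \<open>auto simp: \<kappa>_def\<close>)
  ultimately have le: "expectation (\<lambda>u. barrier (x - V u)) \<le> \<kappa> * \<rho> * exp (b * x)"
    "expectation (\<lambda>u. barrier (x - V u)) \<le> \<kappa>" by (auto simp: prob_space)
  have bx: "barrier x = \<kappa> * min 1 (exp (b * x))" by (simp add: barrier_def \<kappa>_def)
  show ?thesis
  proof (cases "x \<le> 0")
    case True
    then have "b * x \<le> 0" using b_pos by (simp add: mult_nonneg_nonpos)
    then have "barrier x = \<kappa> * exp (b * x)" using bx by (simp add: min_absorb2)
    then have "barrier x - \<kappa> * \<rho> * exp (b * x) = exp b * exp (b * x)"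
      unfolding \<kappa>(2)[symmetric] by (simp add: algebra_simps)
    also have "\<dots> = exp (b * (1 + x))" by (simp add: exp_add[symmetric] algebra_simps)
    also have "\<dots> \<ge> indicator {-1..0} x" using b_pos by (auto simp: indicator_def)
    finally show ?thesis using le by linarith
  next
    case False
    then have "barrier x = \<kappa>" using bx b_pos by (simp add: min_def)
    with False le show ?thesis by simp
  qed
qed

definition barrier_conv :: "real \<Rightarrow> ennreal" where
  "barrier_conv t = (\<integral>\<^sup>+s. ennreal \<bar>g s\<bar> * ennreal (barrier (t - s)) \<partial>lborel)"

lemma barrier_conv_le: "barrier_conv t \<le> ennreal (exp b / (1 - \<rho>) * (\<integral>s. \<bar>g s\<bar> \<partial>lborel))"
proof -
  have "barrier_conv t \<le> (\<integral>\<^sup>+s. ennreal (exp b / (1 - \<rho>) * \<bar>g s\<bar>) \<partial>lborel)"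
    unfolding barrier_conv_def
  proof (rule nn_integral_mono)
    fix s
    have "\<bar>g s\<bar> * barrier (t - s) \<le> \<bar>g s\<bar> * (exp b / (1 - \<rho>))" by (intro mult_left_mono barrier_bounds) simp
    then show "ennreal \<bar>g s\<bar> * ennreal (barrier (t - s)) \<le> ennreal (exp b / (1 - \<rho>) * \<bar>g s\<bar>)"
      using barrier_bounds(1) by (auto simp: ennreal_mult[symmetric] mult.commute intro: ennreal_leI)
  qed
  also have "\<dots> = ennreal (exp b / (1 - \<rho>) * (\<integral>s. \<bar>g s\<bar> \<partial>lborel))"
    using g_int rho by (subst nn_integral_eq_integral) auto
  finally show ?thesis .
qed

text \<open>Integrate \<open>barrier_supersolution\<close> at \<open>t - s\<close> against
  \<open>|g s|\<close>: the condition -1 \<le> t - s \<le> 0 selects the window from t to t + 1.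
  Values in \<open>ennreal\<close> let the integrals be exchanged freely.\<close>

lemma barrier_conv_supersolution:
  "(\<integral>\<^sup>+s. indicator {t..t + 1} s * ennreal \<bar>g s\<bar> \<partial>lborel) + (\<integral>\<^sup>+u. barrier_conv (t - V u) \<partial>Q) \<le> barrier_conv t"
proof -
  have "(\<integral>\<^sup>+u. barrier_conv (t - V u) \<partial>Q) = (\<integral>\<^sup>+s. \<integral>\<^sup>+u. ennreal \<bar>g s\<bar> * ennreal (barrier (t - V u - s)) \<partial>Q \<partial>lborel)"
    unfolding barrier_conv_def by (rule QL.Fubini'[symmetric]) measurable
  then have "(\<integral>\<^sup>+s. indicator {t..t + 1} s * ennreal \<bar>g s\<bar> \<partial>lborel) + (\<integral>\<^sup>+u. barrier_conv (t - V u) \<partial>Q)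
      = (\<integral>\<^sup>+s. indicator {t..t + 1} s * ennreal \<bar>g s\<bar> + (\<integral>\<^sup>+u. ennreal \<bar>g s\<bar> * ennreal (barrier (t - V u - s)) \<partial>Q) \<partial>lborel)"
    by (simp add: nn_integral_add)
  also have "\<dots> \<le> barrier_conv t"
    unfolding barrier_conv_def
  proof (rule nn_integral_mono)
    fix s
    have int: "integrable Q (\<lambda>u. barrier (t - s - V u))"
      by (rule integrable_const_bound[of _ "exp b / (1 - \<rho>)"]) (use barrier_bounds in auto)
    have "(\<integral>\<^sup>+u. ennreal \<bar>g s\<bar> * ennreal (barrier (t - V u - s)) \<partial>Q) = ennreal \<bar>g s\<bar> * (\<integral>\<^sup>+u. ennreal (barrier (t - s - V u)) \<partial>Q)"
      by (subst nn_integral_cmult[symmetric]) (auto simp: algebra_simps)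
    also have "(\<integral>\<^sup>+u. ennreal (barrier (t - s - V u)) \<partial>Q) = ennreal (expectation (\<lambda>u. barrier (t - s - V u)))"
      using int barrier_bounds(1) by (intro nn_integral_eq_integral) auto
    finally have "indicator {t..t + 1} s * ennreal \<bar>g s\<bar> + (\<integral>\<^sup>+u. ennreal \<bar>g s\<bar> * ennreal (barrier (t - V u - s)) \<partial>Q)
        = ennreal \<bar>g s\<bar> * ennreal (indicator {-1..0} (t - s) + expectation (\<lambda>u. barrier (t - s - V u)))"
      using barrier_bounds(1) by (auto simp: indicator_def distrib_left)
    also have "\<dots> \<le> ennreal \<bar>g s\<bar> * ennreal (barrier (t - s))"
      by (intro mult_left_mono ennreal_leI barrier_supersolution) simp
    finally show "indicator {t..t + 1} s * ennreal \<bar>g s\<bar> + (\<integral>\<^sup>+u. ennreal \<bar>g s\<bar> * ennreal (barrier (t - V u - s)) \<partial>Q)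
        \<le> ennreal \<bar>g s\<bar> * ennreal (barrier (t - s))" .
  qed
  finally show ?thesis .
qed

definition window_mass :: "real \<Rightarrow> ennreal" where
  "window_mass t = (\<integral>\<^sup>+s. indicator {t..t + 1} s * ennreal (r s) \<partial>lborel)"

lemma window_mass_subsolution:
  "window_mass t \<le> (\<integral>\<^sup>+s. indicator {t..t + 1} s * ennreal \<bar>g s\<bar> \<partial>lborel) + (\<integral>\<^sup>+u. window_mass (t - V u) \<partial>Q)"
proof -
  have r: "ennreal (r s) \<le> ennreal \<bar>g s\<bar> + (\<integral>\<^sup>+u. ennreal (r (s - V u)) \<partial>Q)" for s
  proof -
    have "(\<integral>\<^sup>+u. ennreal (r (s - V u)) \<partial>Q) = ennreal (expectation (\<lambda>u. r (s - V u)))"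
      using integrable_shift[OF r_meas r_abs_le] r_nonneg by (intro nn_integral_eq_integral) auto
    moreover have "r s \<le> \<bar>g s\<bar> + expectation (\<lambda>u. r (s - V u))" using r_eq[of s] by linarith
    ultimately show ?thesis using r_nonneg by (simp add: ennreal_plus[symmetric] del: ennreal_plus)
  qed
  have "window_mass t \<le> (\<integral>\<^sup>+s. indicator {t..t + 1} s * (ennreal \<bar>g s\<bar> + (\<integral>\<^sup>+u. ennreal (r (s - V u)) \<partial>Q)) \<partial>lborel)"
    unfolding window_mass_def by (intro nn_integral_mono mult_left_mono r) simp
  also have "\<dots> = (\<integral>\<^sup>+s. indicator {t..t + 1} s * ennreal \<bar>g s\<bar> \<partial>lborel)
      + (\<integral>\<^sup>+s. \<integral>\<^sup>+u. indicator {t..t + 1} s * ennreal (r (s - V u)) \<partial>Q \<partial>lborel)"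
    by (simp add: distrib_left nn_integral_add nn_integral_cmult)
  also have "(\<integral>\<^sup>+s. \<integral>\<^sup>+u. indicator {t..t + 1} s * ennreal (r (s - V u)) \<partial>Q \<partial>lborel)
      = (\<integral>\<^sup>+u. \<integral>\<^sup>+s. indicator {t..t + 1} s * ennreal (r (s - V u)) \<partial>lborel \<partial>Q)"
    by (rule QL.Fubini') measurable
  also have "\<dots> = (\<integral>\<^sup>+u. window_mass (t - V u) \<partial>Q)"
  proof (rule nn_integral_cong)
    fix u
    show "(\<integral>\<^sup>+s. indicator {t..t + 1} s * ennreal (r (s - V u)) \<partial>lborel) = window_mass (t - V u)"
      unfolding window_mass_def
      by (subst nn_integral_real_affine[where c = 1 and t = "V u"])
         (auto intro!: nn_integral_cong simp: indicator_def)
  qed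
  finally show ?thesis .
qed

lemma window_mass_meas [measurable]: "window_mass \<in> borel_measurable borel"
  unfolding window_mass_def indicator_def by (simp add: atLeastAtMost_iff)

lemma barrier_conv_meas [measurable]: "barrier_conv \<in> borel_measurable borel"
  unfolding barrier_conv_def by measurable

text \<open>A subsolution is compared with a supersolution. Their difference is at most a multiple
  of \<open>exp (b * t)\<close>, and every use of the two inequalities averages this bound over a
  step, which gains a factor \<open>\<rho>\<close>. The initial \<open>C * exp b\<close> is the
  growth bound at the right end of the window.\<close>

lemma window_mass_le_iterate: "window_mass t \<le> barrier_conv t + ennreal (C * exp b * \<rho> ^ n * exp (b * t))"
proof (induction n arbitrary: t)
  case 0
  have "window_mass t \<le> (\<integral>\<^sup>+s. ennreal (C * exp (b * (t + 1))) * indicator {t..t + 1} s \<partial>lborel)"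
    unfolding window_mass_def
  proof (intro nn_integral_mono)
    fix s
    have "s \<le> t + 1 \<Longrightarrow> r s \<le> C * exp (b * (t + 1))"
      using r_le[of s] C_nonneg b_pos mult_left_mono[of "exp (b * s)" "exp (b * (t + 1))" C] by auto
    then show "indicator {t..t + 1} s * ennreal (r s) \<le> ennreal (C * exp (b * (t + 1))) * indicator {t..t + 1} s"
      by (auto simp: indicator_def intro: ennreal_leI)
  qed
  also have "\<dots> = ennreal (C * exp b * \<rho> ^ 0 * exp (b * t))"
    by (subst nn_integral_cmult) (auto simp: exp_add algebra_simps)
  finally show ?case by (simp add: add_increasing)
next
  case (Suc n)
  define D where "D = C * exp b * \<rho> ^ n"
  have D: "D \<ge> 0" using C_nonneg rho by (simp add: D_def)
  have "window_mass t \<le> (\<integral>\<^sup>+s. indicator {t..t + 1} s * ennreal \<bar>g s\<bar> \<partial>lborel) + (\<integral>\<^sup>+u. window_mass (t - V u) \<partial>Q)"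
    by (rule window_mass_subsolution)
  also have "\<dots> \<le> (\<integral>\<^sup>+s. indicator {t..t + 1} s * ennreal \<bar>g s\<bar> \<partial>lborel)
      + (\<integral>\<^sup>+u. barrier_conv (t - V u) + ennreal (D * exp (b * (t - V u))) \<partial>Q)"
    unfolding D_def by (intro add_left_mono nn_integral_mono Suc.IH)
  also have "(\<integral>\<^sup>+u. barrier_conv (t - V u) + ennreal (D * exp (b * (t - V u))) \<partial>Q)
      = (\<integral>\<^sup>+u. barrier_conv (t - V u) \<partial>Q) + (\<integral>\<^sup>+u. ennreal (D * exp (b * (t - V u))) \<partial>Q)"
    by (rule nn_integral_add) measurable
  also have "(\<integral>\<^sup>+u. ennreal (D * exp (b * (t - V u))) \<partial>Q)
      = ennreal (expectation (\<lambda>u. D * exp (b * (t - V u))))"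
    by (rule nn_integral_eq_integral) (use D exp_int in \<open>auto simp: exp_shift intro!: integrable_mult_right\<close>)
  also have "expectation (\<lambda>u. D * exp (b * (t - V u))) = C * exp b * \<rho> ^ Suc n * exp (b * t)"
    by (simp add: D_def \<rho>_def exp_shift mult_ac del: mult_minus_left)
  also have "(\<integral>\<^sup>+s. indicator {t..t + 1} s * ennreal \<bar>g s\<bar> \<partial>lborel)
      + ((\<integral>\<^sup>+u. barrier_conv (t - V u) \<partial>Q) + ennreal (C * exp b * \<rho> ^ Suc n * exp (b * t)))
      \<le> barrier_conv t + ennreal (C * exp b * \<rho> ^ Suc n * exp (b * t))"
    unfolding add.assoc[symmetric] by (intro add_right_mono barrier_conv_supersolution)
  finally show ?case .
qed

lemma window_mass_le: "window_mass t \<le> barrier_conv t"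
proof (rule LIMSEQ_le_const)
  have "(\<lambda>n. C * exp b * \<rho> ^ n * exp (b * t)) \<longlonglongrightarrow> C * exp b * 0 * exp (b * t)"
    using rho by (intro tendsto_mult tendsto_const LIMSEQ_power_zero) auto
  then have "(\<lambda>n. barrier_conv t + ennreal (C * exp b * \<rho> ^ n * exp (b * t))) \<longlonglongrightarrow> barrier_conv t + ennreal 0"
    by (intro tendsto_add tendsto_const tendsto_ennrealI) simp
  then show "(\<lambda>n. barrier_conv t + ennreal (C * exp b * \<rho> ^ n * exp (b * t))) \<longlonglongrightarrow> barrier_conv t" by simp
qed (use window_mass_le_iterate in blast)

text \<open>By \<open>r_decay\<close> with lag at most 1, \<open>r t\<close> is at most
  \<open>exp a\<close> times each value on the unit window ending at \<open>t\<close>, so bounded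
  averages give bounded values.\<close>

lemma r_bounded: obtains K where "K \<ge> 0" "\<And>t. r t \<le> K"
proof -
  define K where "K = exp b / (1 - \<rho>) * (\<integral>s. \<bar>g s\<bar> \<partial>lborel)"
  have K: "K \<ge> 0" using rho by (auto simp: K_def intro!: mult_nonneg_nonneg divide_nonneg_nonneg)
  have "r t \<le> exp a * K" for t
  proof -
    have "ennreal (exp (- a) * r t) = (\<integral>\<^sup>+s. ennreal (exp (- a) * r t) * indicator {t - 1..t - 1 + 1} s \<partial>lborel)"
      by (simp add: nn_integral_cmult)
    also have "\<dots> \<le> window_mass (t - 1)"
      unfolding window_mass_def
    proof (intro nn_integral_mono)
      fix s
      have "exp (- a) * r t \<le> r s" if "t - 1 \<le> s" "s \<le> t"
      proof -
        have "a * (t - s) \<le> a * 1" using that a_nonneg by (intro mult_left_mono) auto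
        then have "exp (a * (t - s)) * r s \<le> exp a * r s" using r_nonneg by (intro mult_right_mono) auto
        with r_decay[OF that(2)] have "r t \<le> exp a * r s" by linarith
        then show ?thesis by (simp add: exp_minus field_simps)
      qed
      then show "ennreal (exp (- a) * r t) * indicator {t - 1..t - 1 + 1} s
          \<le> indicator {t - 1..t - 1 + 1} s * ennreal (r s)"
        by (auto simp: indicator_def intro: ennreal_leI)
    qed
    also have "\<dots> \<le> ennreal K" using window_mass_le barrier_conv_le order_trans unfolding K_def by blast
    finally have "exp (- a) * r t \<le> K" using K by (simp add: ennreal_le_iff)
    then show ?thesis by (simp add: exp_minus field_simps)
  qed
  with that[of "exp a * K"] K show ?thesis by auto
qed

section \<open>Primitives of the equation and the limit of the window averages\<close>

definition R :: "real \<Rightarrow> real" where "R = prim r"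

definition G :: "real \<Rightarrow> real" where "G = prim g"

lemma R_meas [measurable]: "R \<in> borel_measurable borel"
  unfolding R_def by measurable

lemma G_meas [measurable]: "G \<in> borel_measurable borel"
  unfolding G_def by measurable

lemma R_eq: "R t - expectation (\<lambda>u. R (t - V u)) = G t"
proof -
  have "r t - expectation (\<lambda>u. r (t - V u)) = g t" for t using r_eq[of t] by linarith
  then show ?thesis using prim_eq[OF r_meas r_abs_le, of t] by (simp add: R_def G_def)
qed

lemma R_abs_le: "\<bar>R t\<bar> \<le> C / b * exp (b * t)"
  unfolding R_def by (rule prim_bound[OF r_meas r_abs_le])

lemma G_abs_le: "\<bar>G t\<bar> \<le> C / b * (1 + \<rho>) * exp (b * t)"
  using R_eq[of t] R_abs_le[of t] expectation_shift_bound[OF R_meas R_abs_le, of t]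
  by (simp add: algebra_simps)

lemma G_tendsto: "(G \<longlongrightarrow> (\<integral>s. g s \<partial>lborel)) at_top"
  unfolding G_def prim_def[abs_def] by (rule tendsto_integral_atMost[OF g_int])

lemma G_bounded: "\<bar>G t\<bar> \<le> (\<integral>s. \<bar>g s\<bar> \<partial>lborel)"
  unfolding G_def prim_def
  by (rule abs_integral_le)
     (use g_int in \<open>auto simp: indicator_def intro!: Bochner_Integration.integrable_bound[OF g_int]\<close>)

text \<open>The increments of \<open>R\<close> are bounded and Lipschitz because \<open>r\<close> is
  bounded, and their defect vanishes at infinity because \<open>G\<close> converges. This is all
  that \<open>renewal_limit_lipschitz\<close> asks of a function besides the limit computed in
  \<open>H\<close>.\<close>

lemma window_tendsto:
  assumes h: "h > 0"
  shows "((\<lambda>t. R (t + h) - R t) \<longlongrightarrow> h * (\<integral>s. g s \<partial>lborel) / expectation V) at_top"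
proof -
  obtain K where K: "K \<ge> 0" "\<And>t. r t \<le> K" using r_bounded by blast
  have incr: "R x \<le> R y \<and> R y - R x \<le> K * (y - x)" if "x \<le> y" for x y
  proof -
    have eq: "R y - R x = (\<integral>s. indicator {x<..y} s * r s \<partial>lborel)"
      unfolding R_def by (rule prim_diff[OF r_meas r_abs_le that])
    have "0 \<le> (\<integral>s. indicator {x<..y} s * r s \<partial>lborel)" using r_nonneg by simp
    moreover have "(\<integral>s. indicator {x<..y} s * r s \<partial>lborel) \<le> (\<integral>s. indicator {x<..y} s * K \<partial>lborel)"
    proof (rule integral_mono)
      show ik: "integrable lborel (\<lambda>s. indicator {x<..y} s * K)"
        using that by (intro integrable_mult_left integrable_real_indicator) auto
      show "integrable lborel (\<lambda>s. indicator {x<..y} s * r s)"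
        by (rule Bochner_Integration.integrable_bound[OF ik]) (use r_nonneg K in \<open>auto simp: indicator_def\<close>)
      show "indicator {x<..y} s * r s \<le> indicator {x<..y} s * K" for s
        using K by (auto simp: indicator_def)
    qed
    ultimately show ?thesis using eq that by (simp add: mult.commute)
  qed
  have lipR: "\<bar>R x - R y\<bar> \<le> K * \<bar>x - y\<bar>" for x y
    using incr[of x y] incr[of y x] by (cases "x \<le> y") auto
  define f where "f t = R (t + h) - R t" for t
  have f_meas [measurable]: "f \<in> borel_measurable borel" unfolding f_def by measurable
  have f_bdd: "\<bar>f t\<bar> \<le> K * h" for t using incr[of t "t + h"] h by (simp add: f_def)
  have f_lip: "\<bar>f x - f y\<bar> \<le> 2 * K * \<bar>x - y\<bar>" for x y
    using lipR[of "x + h" "y + h"] lipR[of x y] by (simp add: f_def)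
  have f_exp: "\<bar>f t\<bar> \<le> C / b * (exp (b * h) + 1) * exp (b * t)" for t
    using R_abs_le[of "t + h"] R_abs_le[of t] by (simp add: f_def exp_add algebra_simps)
  have f_eq: "f t - expectation (\<lambda>u. f (t - V u)) = G (t + h) - G t" for t
  proof -
    have "expectation (\<lambda>u. f (t - V u)) = expectation (\<lambda>u. R (t + h - V u)) - expectation (\<lambda>u. R (t - V u))"
      using integrable_shift[OF R_meas R_abs_le] by (simp add: f_def algebra_simps)
    then show ?thesis using R_eq[of t] R_eq[of "t + h"] by (simp add: f_def)
  qed
  have Gh: "((\<lambda>t. G (t + h)) \<longlongrightarrow> (\<integral>s. g s \<partial>lborel)) at_top"
    by (rule filterlim_compose[OF G_tendsto])
       (use filterlim_tendsto_add_at_top[OF tendsto_const[of h] filterlim_ident] in \<open>simp add: add.commute\<close>)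
  have lim0: "((\<lambda>t. f t - expectation (\<lambda>u. f (t - V u))) \<longlongrightarrow> 0) at_top"
    unfolding f_eq using tendsto_diff[OF Gh G_tendsto] by simp
  \<comment> \<open>A second primitive: the left side is the primitive of the defect
    \<open>G (t + h) - G t\<close>, and it telescopes to the integral of \<open>G\<close> over one
    window.\<close>
  have H: "expectation (\<lambda>u. \<integral>y. f (t + y) * signed_ivl (V u) y \<partial>lborel)
      = (\<integral>s. indicator {t<..t + h} s * G s \<partial>lborel)" for t
  proof -
    have "expectation (\<lambda>u. \<integral>y. f (t + y) * signed_ivl (V u) y \<partial>lborel) = expectation (\<lambda>u. prim f t - prim f (t - V u))"
      by (simp add: prim_diff_signed_ivl[OF f_meas f_exp])
    also have "\<dots> = prim f t - expectation (\<lambda>u. prim f (t - V u))"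
      using integrable_shift[OF prim_meas[OF f_meas] prim_bound[OF f_meas f_exp]]
      by (simp add: prob_space)
    also have "\<dots> = prim (\<lambda>t. G (t + h) - G t) t"
      using prim_eq[OF f_meas f_exp, of t] by (simp add: f_eq)
    also have "\<dots> = prim (\<lambda>t. G (t + h)) t - prim G t"
    proof -
      have Gh_le: "\<bar>G (t + h)\<bar> \<le> C / b * (1 + \<rho>) * exp (b * h) * exp (b * t)" for t
        using G_abs_le[of "t + h"] by (simp add: exp_add algebra_simps)
      have "integrable lborel (\<lambda>s. indicator {..t} s * G (s + h))"
        by (rule prim_integrable[OF _ Gh_le]) simp
      moreover have "integrable lborel (\<lambda>s. indicator {..t} s * G s)"
        by (rule prim_integrable[OF G_meas G_abs_le])
      ultimately show ?thesis unfolding prim_def by (simp add: right_diff_distrib)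
    qed
    also have "prim (\<lambda>t. G (t + h)) t = prim G (t + h)"
      unfolding prim_def
      by (subst (2) integral_lborel_shift[of _ h, symmetric])
         (auto intro!: Bochner_Integration.integral_cong simp: indicator_def)
    also have "prim G (t + h) - prim G t = (\<integral>s. indicator {t<..t + h} s * G s \<partial>lborel)"
      using h by (intro prim_diff[OF G_meas G_abs_le]) simp
    finally show ?thesis .
  qed
  have "((\<lambda>t. expectation (\<lambda>u. \<integral>y. f (t + y) * signed_ivl (V u) y \<partial>lborel)) \<longlongrightarrow> h * (\<integral>s. g s \<partial>lborel)) at_top"
    unfolding H by (rule tendsto_window_integral[OF G_meas h G_bounded G_tendsto])
  then have "(f \<longlongrightarrow> h * (\<integral>s. g s \<partial>lborel) / expectation V) at_top"
    by (rule renewal_limit_lipschitz[OF f_bdd f_lip lim0])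
  then show ?thesis by (simp add: f_def[abs_def])
qed

text \<open>A Tauberian comparison: for short windows both exponential factors are close to 1, which
  lets \<open>renewal_theorem\<close> pass from averages to values.\<close>

lemma windobarrier_bounds:
  assumes h: "h > 0"
  shows "R (t + h) - R t \<le> h * (exp (a * h) * r t)" "h * (exp (- a * h) * r (t + h)) \<le> R (t + h) - R t"
proof -
  have eq: "R (t + h) - R t = (\<integral>s. indicator {t<..t + h} s * r s \<partial>lborel)"
    unfolding R_def using h by (intro prim_diff[OF r_meas r_abs_le]) simp
  have ik: "integrable lborel (\<lambda>s. indicator {t<..t + h} s * c)" for c :: real
    using h by (intro integrable_mult_left integrable_real_indicator) auto
  have up: "indicator {t<..t + h} s * r s \<le> indicator {t<..t + h} s * (exp (a * h) * r t)" for s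
  proof (cases "s \<in> {t<..t + h}")
    case True
    then have "a * (s - t) \<le> a * h" using a_nonneg by (intro mult_left_mono) auto
    then have "exp (a * (s - t)) * r t \<le> exp (a * h) * r t" using r_nonneg by (intro mult_right_mono) auto
    with r_decay[of t s] True show ?thesis by simp
  qed simp
  have low: "indicator {t<..t + h} s * (exp (- a * h) * r (t + h)) \<le> indicator {t<..t + h} s * r s" for s
  proof (cases "s \<in> {t<..t + h}")
    case True
    then have "a * (t + h - s) \<le> a * h" using a_nonneg by (intro mult_left_mono) auto
    then have "exp (a * (t + h - s)) * r s \<le> exp (a * h) * r s" using r_nonneg by (intro mult_right_mono) auto
    with r_decay[of s "t + h"] True have "r (t + h) \<le> exp (a * h) * r s" by simp
    with True show ?thesis by (simp add: exp_minus field_simps)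
  qed simp
  have ir: "integrable lborel (\<lambda>s. indicator {t<..t + h} s * r s)"
  proof (rule Bochner_Integration.integrable_bound[OF ik[of "exp (a * h) * r t"]])
    have "norm (indicator {t<..t + h} s * r s) \<le> norm (indicator {t<..t + h} s * (exp (a * h) * r t))" for s
    proof -
      have "0 \<le> indicator {t<..t + h} s * r s" using r_nonneg by simp
      with up[of s] show ?thesis unfolding real_norm_def by linarith
    qed
    then show "AE s in lborel. norm (indicator {t<..t + h} s * r s) \<le> norm (indicator {t<..t + h} s * (exp (a * h) * r t))"
      by (rule AE_I2)
  qed measurable
  show "R (t + h) - R t \<le> h * (exp (a * h) * r t)"
    unfolding eq using integral_mono[OF ir ik[of "exp (a * h) * r t"] up] h by simp
  show "h * (exp (- a * h) * r (t + h)) \<le> R (t + h) - R t"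
    unfolding eq using integral_mono[OF ik[of "exp (- a * h) * r (t + h)"] ir low] h by simp
qed

theorem renewal_theorem: "(r \<longlongrightarrow> (\<integral>s. g s \<partial>lborel) / expectation V) at_top"
proof (rule order_tendstoI)
  define c where "c = (\<integral>s. g s \<partial>lborel) / expectation V"
  have win: "((\<lambda>t. (R (t + h) - R t) / h) \<longlongrightarrow> c) at_top" if "h > 0" for h
    using tendsto_divide[OF window_tendsto[OF that] tendsto_const[of h]] that by (simp add: c_def)
  fix y
  {
    assume y: "y < (\<integral>s. g s \<partial>lborel) / expectation V"
    \<comment> \<open>The window length is chosen after \<open>y\<close>, so small that the factor
      \<open>exp (a * h)\<close> does not close the gap between \<open>y\<close> and
      \<open>c\<close>.\<close>
    have "((\<lambda>h. exp (a * h) * y) \<longlongrightarrow> exp (a * 0) * y) (at_right 0)"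
      by (intro tendsto_intros)
    then have "\<forall>\<^sub>F h in at_right 0. exp (a * h) * y < c"
      using y by (auto simp: c_def intro!: order_tendstoD(2))
    then have "\<forall>\<^sub>F h in at_right 0. exp (a * h) * y < c \<and> 0 < h"
      using eventually_at_right_less by (rule eventually_conj)
    then have "\<exists>h. exp (a * h) * y < c \<and> 0 < h" by (rule eventually_happens'[rotated]) simp
    then obtain h where h: "exp (a * h) * y < c" "h > 0" by blast
    have "\<forall>\<^sub>F t in at_top. exp (a * h) * y < (R (t + h) - R t) / h"
      by (rule order_tendstoD(1)[OF win[OF h(2)] h(1)])
    then show "\<forall>\<^sub>F t in at_top. y < r t"
    proof eventually_elim
      case (elim t)
      also have "(R (t + h) - R t) / h \<le> exp (a * h) * r t"
        using windobarrier_bounds(1)[OF h(2), of t] h by (simp add: field_simps)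
      finally show ?case by simp
    qed
  next
    assume y: "(\<integral>s. g s \<partial>lborel) / expectation V < y"
    have "((\<lambda>h. exp (- a * h) * y) \<longlongrightarrow> exp (- a * 0) * y) (at_right 0)"
      by (intro tendsto_intros)
    then have "\<forall>\<^sub>F h in at_right 0. c < exp (- a * h) * y"
      using y by (auto simp: c_def intro!: order_tendstoD(1))
    then have "\<forall>\<^sub>F h in at_right 0. c < exp (- a * h) * y \<and> 0 < h"
      using eventually_at_right_less by (rule eventually_conj)
    then have "\<exists>h. c < exp (- a * h) * y \<and> 0 < h" by (rule eventually_happens'[rotated]) simp
    then obtain h where h: "c < exp (- a * h) * y" "h > 0" by blast
    \<comment> \<open>The second comparison controls the value at the right end, so the window
      ending at \<open>t\<close> is used.\<close>
    have "((\<lambda>t. (R (t - h + h) - R (t - h)) / h) \<longlongrightarrow> c) at_top"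
      by (rule filterlim_compose[OF win[OF h(2)]])
         (use filterlim_tendsto_add_at_top[OF tendsto_const[of "- h"] filterlim_ident] in simp)
    then have "\<forall>\<^sub>F t in at_top. (R (t - h + h) - R (t - h)) / h < exp (- a * h) * y"
      by (rule order_tendstoD(2)[OF _ h(1)])
    then show "\<forall>\<^sub>F t in at_top. r t < y"
    proof eventually_elim
      case (elim t)
      have "exp (- a * h) * r t \<le> (R (t - h + h) - R (t - h)) / h"
        using windobarrier_bounds(2)[OF h(2), of "t - h"] h by (simp add: field_simps)
      with elim have "exp (- a * h) * r t < exp (- a * h) * y" by linarith
      then show ?case by simp
    qed
  }
qed

end

section \<open>Implicit renewal\<close>

lemma has_bochner_integral_exp_below:
  fixes a z :: real
  assumes a: "a > 0" and z: "0 \<le> z"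
  shows "has_bochner_integral lborel (\<lambda>t. exp (a * t) * of_bool (exp t < z)) (z powr a / a)"
proof (cases "z = 0")
  case True
  then have "(\<lambda>t. exp (a * t) * of_bool (exp t < z)) = (\<lambda>_. 0 :: real)"
    by (auto simp: not_less order.asym)
  then show ?thesis using True by (simp add: has_bochner_integral_zero)
next
  case False
  with z have z: "z > 0" by simp
  \<comment> \<open>The conditions \<open>exp t < z\<close> and t \<le> ln z differ at this single
    point.\<close>
  have "AE t in lborel. t \<noteq> ln z" by (rule AE_lborel_singleton)
  then have "AE t in lborel. indicator {..ln z} t * exp (a * t) = exp (a * t) * of_bool (exp t < z)"
  proof eventually_elim
    case (elim t)
    have "exp t < z \<longleftrightarrow> t < ln z" using z by (metis exp_less_cancel_iff exp_ln)
    with elim show ?case by (auto simp: indicator_def)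
  qed
  moreover have "has_bochner_integral lborel (\<lambda>t. indicator {..ln z} t * exp (a * t)) (z powr a / a)"
    using has_bochner_integral_exp_atMost[OF a, of "ln z"] z by (simp add: powr_def)
  ultimately show ?thesis
    by (subst has_bochner_integral_cong_AE[symmetric]) (auto simp del: of_bool_eq)
qed

text \<open>As \<open>k\<close> has constant sign, the integral of its absolute value is the
  absolute value of its integral. This is how integrability of a difference of powers makes the
  forcing term of the renewal equation integrable.\<close>

lemma integral_exp_between:
  fixes a z w :: real
  assumes a: "a > 0" and z: "0 \<le> z" and w: "0 \<le> w"
  defines "k \<equiv> \<lambda>t. exp (a * t) * (of_bool (exp t < z) - of_bool (exp t < w))"
  shows "integrable lborel k" "(\<integral>t. k t \<partial>lborel) = (z powr a - w powr a) / a"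
    "(\<integral>t. \<bar>k t\<bar> \<partial>lborel) = \<bar>z powr a - w powr a\<bar> / a"
proof -
  have hb: "has_bochner_integral lborel k ((z powr a - w powr a) / a)"
    unfolding k_def right_diff_distrib diff_divide_distrib
    by (intro has_bochner_integral_diff has_bochner_integral_exp_below a z w)
  then show "integrable lborel k" and eq: "(\<integral>t. k t \<partial>lborel) = (z powr a - w powr a) / a"
    by (auto simp: has_bochner_integral_iff)
  show "(\<integral>t. \<bar>k t\<bar> \<partial>lborel) = \<bar>z powr a - w powr a\<bar> / a"
  proof (cases "w \<le> z")
    case True
    then have "\<bar>k t\<bar> = k t" for t by (auto simp: k_def)
    then show ?thesis using eq True a w by (simp add: powr_mono2)
  next
    case False
    then have "\<bar>k t\<bar> = - k t" for t by (auto simp: k_def)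
    moreover have "z powr a \<le> w powr a" using False a z by (intro powr_mono2) auto
    ultimately show ?thesis using eq by (simp add: minus_divide_left)
  qed
qed

lemma tail_integral:
  fixes Z :: "'a \<Rightarrow> real"
  assumes "prob_space M" and [measurable]: "Z \<in> borel_measurable M"
  shows "(\<integral>x. of_bool (c < Z x) \<partial>M) = measure M {x \<in> space M. c < Z x}" (is "?I = _")
    and "integrable M (\<lambda>x. of_bool (c < Z x) :: real)"
proof -
  interpret prob_space M by fact
  have "?I = (\<integral>x. indicator {x \<in> space M. c < Z x} x \<partial>M)"
    by (intro Bochner_Integration.integral_cong) (auto simp: indicator_def)
  also have "\<dots> = measure M {x \<in> space M. c < Z x}"
    by (subst Bochner_Integration.integral_indicator) (auto intro!: arg_cong[where f = "measure M"])
  finally show "?I = measure M {x \<in> space M. c < Z x}" .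
  show "integrable M (\<lambda>x. of_bool (c < Z x) :: real)"
    by (rule integrable_const_bound[of _ 1]) auto
qed

text \<open>This is a form of Goldie's implicit renewal theorem: \<open>Z'\<close> has the law of
  \<open>Z\<close> and is compared with \<open>A * Z\<close>, the forcing term being the scaled
  difference of their tails. The two powers need not be integrable separately, only their
  difference.\<close>

theorem implicit_renewal:
  fixes P :: "'a measure" and N :: "'b measure" and A :: "'a \<Rightarrow> real" and Z :: "'b \<Rightarrow> real"
    and Z' :: "'a \<times> 'b \<Rightarrow> real" and a p :: real
  assumes P: "prob_space P" and N: "prob_space N"
    and A_meas [measurable]: "A \<in> borel_measurable P" and A_pos: "\<And>\<theta>. A \<theta> > 0"
    and p: "0 < p" "p < a"
    and A_int: "integrable P (\<lambda>\<theta>. A \<theta> powr a)" "(\<integral>\<theta>. A \<theta> powr a \<partial>P) = 1"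
    and A_p: "integrable P (\<lambda>\<theta>. A \<theta> powr p)" "(\<integral>\<theta>. A \<theta> powr p \<partial>P) < 1"
    and A_log: "integrable P (\<lambda>\<theta>. A \<theta> powr a * ln (A \<theta>))"
    and nonarith: "\<not> (\<exists>c>0. AE \<theta> in P. ln (A \<theta>) \<in> {c * of_int k | k. True})"
    and Z_meas [measurable]: "Z \<in> borel_measurable N" and Z_nonneg: "\<And>x. 0 \<le> Z x"
    and Z_p: "integrable N (\<lambda>x. Z x powr p)"
    and Z'_meas [measurable]: "Z' \<in> borel_measurable (P \<Otimes>\<^sub>M N)" and Z'_nonneg: "\<And>x. 0 \<le> Z' x"
    and law: "\<And>t. measure (P \<Otimes>\<^sub>M N) {x \<in> space (P \<Otimes>\<^sub>M N). t < Z' x} = measure N {x \<in> space N. t < Z x}"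
    and diff_int: "integrable (P \<Otimes>\<^sub>M N) (\<lambda>x. Z' x powr a - (A (fst x) * Z (snd x)) powr a)"
  defines "m \<equiv> (\<integral>\<theta>. A \<theta> powr a * ln (A \<theta>) \<partial>P)"
  shows "m > 0"
    and "((\<lambda>t. t powr a * measure N {x \<in> space N. t < Z x}) \<longlongrightarrow>
           (\<integral>x. Z' x powr a - (A (fst x) * Z (snd x)) powr a \<partial>(P \<Otimes>\<^sub>M N)) / (a * m)) at_top"
proof -
  interpret P: prob_space P by fact
  interpret N: prob_space N by fact
  interpret PN: pair_prob_space P N ..
  have a: "a > 0" using p by simp
  have pow_pos: "0 < A \<theta> powr a" for \<theta> using A_pos[of \<theta>] by simp
  \<comment> \<open>The tilted law is a probability because \<open>A powr a\<close> has mean 1, and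
    it has the same null sets as \<open>P\<close> because \<open>A\<close> is positive.\<close>
  define Q where "Q = density P (\<lambda>\<theta>. ennreal (A \<theta> powr a))"
  define V where "V \<theta> = ln (A \<theta>)" for \<theta>
  define b where "b = a - p"
  have Q_sets [measurable_cong]: "sets Q = sets P" by (simp add: Q_def)
  have V_meas [measurable]: "V \<in> borel_measurable P" unfolding V_def by measurable
  have Qint: "integrable Q f \<longleftrightarrow> integrable P (\<lambda>\<theta>. A \<theta> powr a * f \<theta>)"
    "(\<integral>\<theta>. f \<theta> \<partial>Q) = (\<integral>\<theta>. A \<theta> powr a * f \<theta> \<partial>P)"
    if "f \<in> borel_measurable P" for f :: "'a \<Rightarrow> real"
    unfolding Q_def using that by (auto simp: integrable_density integral_density)
  have Q_AE: "(AE \<theta> in Q. R \<theta>) \<longleftrightarrow> (AE \<theta> in P. R \<theta>)" for R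
    unfolding Q_def using pow_pos by (subst AE_density) auto
  interpret Q: prob_space Q
  proof
    have "emeasure Q (space Q) = (\<integral>\<^sup>+\<theta>. ennreal (A \<theta> powr a) \<partial>P)"
      unfolding Q_def by (subst emeasure_density) (auto intro!: nn_integral_cong simp: indicator_def)
    also have "\<dots> = 1" using A_int by (subst nn_integral_eq_integral) auto
    finally show "emeasure Q (space Q) = 1" .
  qed
  have expV: "A \<theta> powr a * exp (- b * V \<theta>) = A \<theta> powr p" for \<theta>
    using A_pos[of \<theta>] by (simp add: powr_def b_def V_def exp_add[symmetric] algebra_simps)
  have V_int: "integrable Q V" and mQ: "Q.expectation V = m"
    using A_log by (auto simp: Qint V_def m_def)
  have e_int: "integrable Q (\<lambda>\<theta>. exp (- b * V \<theta>))" and e_lt: "Q.expectation (\<lambda>\<theta>. exp (- b * V \<theta>)) < 1"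
    using A_p expV by (auto simp: Qint)
  have b: "b > 0" using p by (simp add: b_def)
  \<comment> \<open>Positive drift: taking means in 1 - b V \<le> exp(-b V) gives 1 - b m <
    1.\<close>
  have "Q.expectation (\<lambda>\<theta>. 1 - b * V \<theta>) \<le> Q.expectation (\<lambda>\<theta>. exp (- b * V \<theta>))"
  proof (rule integral_mono)
    show "1 - b * V \<theta> \<le> exp (- b * V \<theta>)" for \<theta> using exp_ge_add_one_self[of "- b * V \<theta>"] by simp
  qed (use V_int e_int in auto)
  then have "0 < b * m" using e_lt V_int mQ by (simp add: Q.prob_space)
  then show m: "m > 0" using b by (simp add: zero_less_mult_iff)
  \<comment> \<open>Otherwise \<open>A powr a\<close> would be at least 1 with mean 1, so
    \<open>A = 1\<close> almost surely, and then ln A would be supported on every lattice.\<close>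
  have V_neg: "\<not> (AE \<theta> in Q. 0 \<le> V \<theta>)"
  proof
    assume "AE \<theta> in Q. 0 \<le> V \<theta>"
    then have "AE \<theta> in P. 0 \<le> V \<theta>" by (simp add: Q_AE)
    then have ge: "AE \<theta> in P. 0 \<le> A \<theta> powr a - 1"
    proof eventually_elim
      case (elim \<theta>)
      then have "1 \<le> A \<theta>" using A_pos[of \<theta>] by (simp add: V_def)
      then show ?case using a by (simp add: ge_one_powr_ge_zero)
    qed
    have "(\<integral>\<theta>. A \<theta> powr a - 1 \<partial>P) = 0" using A_int by (simp add: P.prob_space)
    then have "AE \<theta> in P. A \<theta> powr a - 1 = 0"
      using integral_nonneg_eq_0_iff_AE[OF _ ge] A_int by simp
    then have "AE \<theta> in P. ln (A \<theta>) \<in> {1 * of_int k | k. True}"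
    proof eventually_elim
      case (elim \<theta>)
      then have "ln (A \<theta> powr a) = 0" by simp
      then have "ln (A \<theta>) = 0" using a A_pos[of \<theta>] by (simp add: ln_powr)
      then show ?case by (auto intro: exI[of _ 0])
    qed
    with nonarith show False by (meson zero_less_one)
  qed
  have Q_nonarith: "\<not> (\<exists>c>0. AE \<theta> in Q. V \<theta> \<in> {c * of_int k | k. True})"
    using nonarith unfolding Q_AE V_def .
  define T :: "real \<Rightarrow> real" where "T t = (\<integral>x. of_bool (exp t < Z x) \<partial>N)" for t
  have T_meas [measurable]: "T \<in> borel_measurable borel"
    unfolding T_def by measurable
  have T_nonneg: "0 \<le> T t" for t unfolding T_def by simp
  define r where "r t = exp (a * t) * T t" for t
  define k :: "'a \<times> 'b \<Rightarrow> real \<Rightarrow> real" where "k x t = exp (a * t) * (of_bool (exp t < Z' x) - of_bool (exp t < A (fst x) * Z (snd x)))" for x t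
  define g where "g t = (\<integral>x. k x t \<partial>(P \<Otimes>\<^sub>M N))" for t
  interpret L: pair_sigma_finite "P \<Otimes>\<^sub>M N" lborel ..
  have k_meas [measurable]: "case_prod k \<in> borel_measurable ((P \<Otimes>\<^sub>M N) \<Otimes>\<^sub>M lborel)"
    unfolding k_def by measurable
  have AZ: "0 \<le> A \<theta> * Z x" for \<theta> x using A_pos[of \<theta>] Z_nonneg[of x] by simp
  have k_int: "integrable ((P \<Otimes>\<^sub>M N) \<Otimes>\<^sub>M lborel) (case_prod k)"
  proof (rule L.Fubini_integrable)
    have "(\<integral>t. norm (case_prod k (x, t)) \<partial>lborel) = \<bar>Z' x powr a - (A (fst x) * Z (snd x)) powr a\<bar> / a" for x
      using integral_exp_between(3)[OF a Z'_nonneg[of x] AZ[of "fst x" "snd x"]] by (simp add: k_def)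
    then show "integrable (P \<Otimes>\<^sub>M N) (\<lambda>x. \<integral>t. norm (case_prod k (x, t)) \<partial>lborel)"
      using diff_int by simp
    show "AE x in P \<Otimes>\<^sub>M N. integrable lborel (\<lambda>t. case_prod k (x, t))"
      using integral_exp_between(1)[OF a Z'_nonneg AZ] by (simp add: k_def)
  qed measurable
  have g_int: "integrable lborel g"
    unfolding g_def by (rule L.integrable_snd[OF k_int])
  have g_integral: "(\<integral>t. g t \<partial>lborel) = (\<integral>x. Z' x powr a - (A (fst x) * Z (snd x)) powr a \<partial>(P \<Otimes>\<^sub>M N)) / a"
  proof -
    have "(\<integral>t. g t \<partial>lborel) = (\<integral>x. \<integral>t. k x t \<partial>lborel \<partial>(P \<Otimes>\<^sub>M N))"
      unfolding g_def by (rule L.Fubini_integral[OF k_int])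
    also have "\<dots> = (\<integral>x. (Z' x powr a - (A (fst x) * Z (snd x)) powr a) / a \<partial>(P \<Otimes>\<^sub>M N))"
      unfolding k_def using integral_exp_between(2)[OF a Z'_nonneg AZ] by simp
    finally show ?thesis by simp
  qed
  \<comment> \<open>The density \<open>A powr a\<close> compensates the shift in
    \<open>exp (a * (t - V \<theta>))\<close>, so the tilted expectation is the scaled tail of
    \<open>A * Z\<close>.\<close>
  have r_eq: "r t = g t + Q.expectation (\<lambda>\<theta>. r (t - V \<theta>))" for t
  proof -
    have int1: "integrable (P \<Otimes>\<^sub>M N) (\<lambda>x. of_bool (exp t < Z' x) :: real)"
      and eq1: "(\<integral>x. of_bool (exp t < Z' x) \<partial>(P \<Otimes>\<^sub>M N)) = T t"
      using tail_integral[OF PN.prob_space_axioms Z'_meas] tail_integral[OF N Z_meas] law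
      by (auto simp: T_def)
    have int2: "integrable (P \<Otimes>\<^sub>M N) (\<lambda>x. of_bool (exp t < A (fst x) * Z (snd x)) :: real)"
      by (rule tail_integral(2)[OF PN.prob_space_axioms]) measurable
    have "Q.expectation (\<lambda>\<theta>. r (t - V \<theta>)) = (\<integral>\<theta>. A \<theta> powr a * r (t - V \<theta>) \<partial>P)"
      by (rule Qint(2)) (simp add: r_def)
    also have "\<dots> = (\<integral>\<theta>. exp (a * t) * (\<integral>x. of_bool (exp t < A \<theta> * Z x) \<partial>N) \<partial>P)"
    proof (rule Bochner_Integration.integral_cong[OF refl])
      fix \<theta>
      have "exp (t - V \<theta>) < Z x \<longleftrightarrow> exp t < A \<theta> * Z x" for x
        using A_pos[of \<theta>] by (simp add: V_def exp_diff field_simps)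
      moreover have "A \<theta> powr a * exp (a * (t - V \<theta>)) = exp (a * t)"
        using A_pos[of \<theta>] by (simp add: powr_def V_def exp_add[symmetric] algebra_simps)
      ultimately show "A \<theta> powr a * r (t - V \<theta>) = exp (a * t) * (\<integral>x. of_bool (exp t < A \<theta> * Z x) \<partial>N)"
        by (simp add: r_def T_def mult.assoc[symmetric])
    qed
    also have "\<dots> = exp (a * t) * (\<integral>x. of_bool (exp t < A (fst x) * Z (snd x)) \<partial>(P \<Otimes>\<^sub>M N))"
      using PN.integral_fst'[OF int2] by simp
    finally have "Q.expectation (\<lambda>\<theta>. r (t - V \<theta>)) =
        exp (a * t) * (\<integral>x. of_bool (exp t < A (fst x) * Z (snd x)) \<partial>(P \<Otimes>\<^sub>M N))" .
    moreover have "g t = exp (a * t) * (T t - (\<integral>x. of_bool (exp t < A (fst x) * Z (snd x)) \<partial>(P \<Otimes>\<^sub>M N)))"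
      unfolding g_def k_def eq1[symmetric] using int1 int2 by (subst Bochner_Integration.integral_diff[symmetric]) auto
    ultimately show ?thesis by (simp add: r_def algebra_simps)
  qed
  have T_mono: "T t \<le> T s" if "s \<le> t" for s t
    unfolding T_def
  proof (intro integral_mono tail_integral(2)[OF N Z_meas])
    show "(of_bool (exp t < Z x) :: real) \<le> of_bool (exp s < Z x)" for x
      using that exp_le_cancel_iff[of s t] by (auto simp del: exp_le_cancel_iff)
  qed
  \<comment> \<open>The growth constant is the moment of order \<open>p\<close>: Markov's inequality
    bounds \<open>exp (p * t) * T t\<close> by it, and \<open>a = b + p\<close>.\<close>
  interpret renewal_equation Q V b r g "\<integral>x. Z x powr p \<partial>N" a
  proof
    show "integrable Q V" "0 < Q.expectation V" using V_int mQ m by auto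
    show "\<not> (AE w in Q. 0 \<le> V w)" by (rule V_neg)
    show "\<not> (\<exists>c>0. AE w in Q. V w \<in> {c * of_int k | k. True})" by (rule Q_nonarith)
    show "0 < b" "integrable Q (\<lambda>w. exp (- b * V w))" "Q.expectation (\<lambda>w. exp (- b * V w)) < 1"
      using b e_int e_lt by auto
    show "r \<in> borel_measurable borel" unfolding r_def by measurable
    show "0 \<le> r t" for t using T_nonneg by (simp add: r_def)
    show "r t \<le> (\<integral>x. Z x powr p \<partial>N) * exp (b * t)" for t
    proof -
      have "exp (p * t) * T t = (\<integral>x. exp (p * t) * of_bool (exp t < Z x) \<partial>N)" by (simp add: T_def)
      also have "\<dots> \<le> (\<integral>x. Z x powr p \<partial>N)"
      proof (rule integral_mono[OF _ Z_p])
        show "integrable N (\<lambda>x. exp (p * t) * of_bool (exp t < Z x))"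
          by (intro integrable_mult_right tail_integral(2)[OF N Z_meas])
        show "exp (p * t) * of_bool (exp t < Z x) \<le> Z x powr p" for x
        proof (cases "exp t < Z x")
          case True
          then have "exp t powr p \<le> Z x powr p" using p by (intro powr_mono2) auto
          with True show ?thesis by (simp add: powr_def)
        qed simp
      qed
      finally have "exp (b * t) * (exp (p * t) * T t) \<le> exp (b * t) * (\<integral>x. Z x powr p \<partial>N)"
        by (intro mult_left_mono) auto
      moreover have "exp (b * t) * exp (p * t) = exp (a * t)"
        by (simp add: b_def exp_add[symmetric] algebra_simps)
      then have "exp (b * t) * (exp (p * t) * T t) = r t"
        by (simp add: r_def mult.assoc[symmetric])
      ultimately show ?thesis by (metis mult.commute)
    qed
    show "0 \<le> a" using a by simp
    show "r t \<le> exp (a * (t - s)) * r s" if "s \<le> t" for s t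
    proof -
      have "exp (a * (t - s)) * exp (a * s) = exp (a * t)"
        by (simp add: exp_add[symmetric] algebra_simps)
      then have "exp (a * (t - s)) * r s = exp (a * t) * T s"
        by (simp add: r_def mult.assoc[symmetric])
      moreover have "r t \<le> exp (a * t) * T s" using T_mono[OF that] by (simp add: r_def)
      ultimately show ?thesis by linarith
    qed
    show "integrable lborel g" by (rule g_int)
    show "r t = g t + Q.expectation (\<lambda>w. r (t - V w))" for t by (rule r_eq)
  qed
  have "(r \<longlongrightarrow> (\<integral>x. Z' x powr a - (A (fst x) * Z (snd x)) powr a \<partial>(P \<Otimes>\<^sub>M N)) / (a * m)) at_top"
    using renewal_theorem unfolding g_integral mQ by simp
  then have lim: "((\<lambda>t. r (ln t)) \<longlongrightarrow> (\<integral>x. Z' x powr a - (A (fst x) * Z (snd x)) powr a \<partial>(P \<Otimes>\<^sub>M N)) / (a * m)) at_top"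
    by (rule filterlim_compose[OF _ ln_at_top])
  have "\<forall>\<^sub>F t in at_top. r (ln t) = t powr a * measure N {x \<in> space N. t < Z x}"
    using eventually_gt_at_top[of 0]
  proof eventually_elim
    case (elim t)
    then show ?case using tail_integral(1)[OF N Z_meas, of t] by (simp add: r_def T_def powr_def)
  qed
  with lim show "((\<lambda>t. t powr a * measure N {x \<in> space N. t < Z x}) \<longlongrightarrow>
      (\<integral>x. Z' x powr a - (A (fst x) * Z (snd x)) powr a \<partial>(P \<Otimes>\<^sub>M N)) / (a * m)) at_top"
    by (rule Lim_transform_eventually)
qed

section \<open>Moments and power inequalities\<close>

text \<open>The right side is the tangent at 1 of a concave power.\<close>

lemma powr_le_affine:
  fixes u c :: real
  assumes "0 \<le> u" "0 < c" "c \<le> 1"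
  shows "u powr c \<le> c * u + (1 - c)"
proof (cases "u = 0")
  case False
  then show ?thesis using Youngs_inequality_0[of c "1 - c" u 1] assms by simp
qed (use assms in auto)

text \<open>With u = exp v, dividing by exp(c v) makes a convex combination of exp((1 - c) v) and
  exp(-c v) equal to 1. The same combination of their tangents is already 1, so the bound for exp(-c
  v) is attained and v = 0.\<close>

lemma powr_eq_affine:
  fixes u c :: real
  assumes u: "0 < u" and c: "0 < c" "c < 1" and eq: "u powr c = c * u + (1 - c)"
  shows "u = 1"
proof -
  define v where "v = ln u"
  have v: "u = exp v" using u by (simp add: v_def)
  have e: "1 + y \<le> exp y" for y :: real by (rule exp_ge_add_one_self)
  have "c * exp v + (1 - c) = exp (c * v) * (c * exp ((1 - c) * v) + (1 - c) * exp (- (c * v)))"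
    by (simp add: distrib_left exp_add[symmetric] exp_minus algebra_simps)
  moreover have "c * exp v + (1 - c) = exp (c * v) * 1" using eq by (simp add: v powr_def)
  ultimately have "c * exp ((1 - c) * v) + (1 - c) * exp (- (c * v)) = 1" by simp
  moreover have "c * (1 + (1 - c) * v) \<le> c * exp ((1 - c) * v)"
    using e c by (intro mult_left_mono) auto
  ultimately have "(1 - c) * exp (- (c * v)) \<le> (1 - c) * (1 + - (c * v))" by (simp add: algebra_simps)
  then have "exp (- (c * v)) \<le> 1 + - (c * v)" using c by simp
  with e[of "- (c * v)"] have "ln (exp (- (c * v))) = exp (- (c * v)) - 1" unfolding ln_exp by linarith
  then have "exp (- (c * v)) = 1" by (intro ln_eq_minus_one) auto
  then show ?thesis using c by (simp add: v)
qed

lemma powr_add_le_powr: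
  fixes x y c :: real
  assumes "0 \<le> x" "0 \<le> y" "0 < c" "c \<le> 1"
  shows "(x + y) powr c \<le> x powr c + y powr c"
proof (cases "x + y = 0")
  case False
  define s where "s = x + y"
  have s: "s > 0" using assms False by (simp add: s_def)
  have le: "u / s \<le> (u / s) powr c" if "0 \<le> u" "u \<le> s" for u
    using powr_mono'[of c 1 "u / s"] that s assms by simp
  have "1 = x / s + y / s" using s by (simp add: s_def add_divide_distrib[symmetric])
  also have "\<dots> \<le> (x / s) powr c + (y / s) powr c"
    using assms by (intro add_mono le) (auto simp: s_def)
  also have "\<dots> = (x powr c + y powr c) / s powr c"
    using assms s by (simp add: powr_divide add_divide_distrib)
  finally show ?thesis using s by (simp add: field_simps s_def)
qed (use assms in auto)

text \<open>Bernoulli's inequality, obtained from the tangent bound with exponent 1/c at the point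
  (y/x)^c and then multiplied by c x^c.\<close>

lemma powr_diff_le:
  fixes x y c :: real
  assumes "0 \<le> y" "y \<le> x" "1 \<le> c"
  shows "x powr c - y powr c \<le> c * (x - y) * x powr (c - 1)"
proof (cases "x = 0")
  case False
  then have x: "x > 0" using assms by simp
  have "((y / x) powr c) powr (1 / c) \<le> 1 / c * (y / x) powr c + (1 - 1 / c)"
    by (rule powr_le_affine) (use assms in auto)
  then have "y / x \<le> 1 / c * (y / x) powr c + (1 - 1 / c)"
    using assms x by (simp add: powr_powr)
  then have "c * (y / x) \<le> c * (1 / c * (y / x) powr c + (1 - 1 / c))"
    using assms by (intro mult_left_mono) auto
  also have "\<dots> = (y / x) powr c + c - 1" using assms by (simp add: algebra_simps)
  finally have "c * (y / x) * x powr c \<le> (y powr c / x powr c + c - 1) * x powr c"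
    using assms x by (intro mult_right_mono) (auto simp: powr_divide)
  moreover have "(y powr c / x powr c + c - 1) * x powr c = y powr c + (c - 1) * x powr c"
    using x by (simp add: field_simps)
  moreover have xc: "x powr c = x * x powr (c - 1)" using x by (simp add: powr_diff)
  then have "c * (y / x) * x powr c = c * y * x powr (c - 1)" using x by simp
  ultimately have "c * y * x powr (c - 1) \<le> y powr c + (c * x powr c - x powr c)"
    by (simp add: left_diff_distrib)
  moreover have "c * (x - y) * x powr (c - 1) = c * x powr c - c * y * x powr (c - 1)"
    unfolding xc by (simp add: algebra_simps)
  ultimately show ?thesis by linarith
qed (use assms in auto)

lemma powr_mult_le_add:
  fixes s t c d :: real
  assumes "0 \<le> s" "0 \<le> t" "0 < c" "0 < d"
  shows "s powr c * t powr d \<le> s powr (c + d) + t powr (c + d)"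
proof (cases "s \<le> t")
  case True
  then have "s powr c * t powr d \<le> t powr c * t powr d" using assms by (intro mult_right_mono powr_mono2) auto
  then show ?thesis by (simp add: powr_add[symmetric] add_increasing)
next
  case False
  then have "s powr c * t powr d \<le> s powr c * s powr d" using assms by (intro mult_left_mono powr_mono2) auto
  then show ?thesis by (simp add: powr_add[symmetric] add_increasing2)
qed

text \<open>For a \<le> 1 powers are subadditive. For a > 1 the difference is at most a b (y + b)^(a
  - 1); if y > b, moving the nonnegative exponent 1 - a + \<beta> from b to y turns b y^(a - 1) into
  b^(a - \<beta>) y^\<beta>. Keeping only the power \<beta> < a of y means that a lower moment of y
  suffices.\<close>

lemma abs_powr_diff_le:
  fixes x y b a \<beta> :: real
  assumes xy: "0 \<le> x" "0 \<le> y" "\<bar>x - y\<bar> \<le> b" and a: "0 < \<beta>" "\<beta> < a" "a - 1 \<le> \<beta>"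
  shows "\<bar>x powr a - y powr a\<bar> \<le> (1 + a * 2 powr (a - 1)) * (b powr a + b powr (a - \<beta>) * y powr \<beta>)"
proof -
  have b: "0 \<le> b" using xy by linarith
  have rhs: "c * (b powr a + b powr (a - \<beta>) * y powr \<beta>) \<le> (1 + a * 2 powr (a - 1)) * (b powr a + b powr (a - \<beta>) * y powr \<beta>)"
    if "c \<le> 1 + a * 2 powr (a - 1)" for c
    using that by (intro mult_right_mono) auto
  show ?thesis
  proof (cases "a \<le> 1")
    case True
    have sub: "u powr a \<le> v powr a + b powr a" if "0 \<le> u" "0 \<le> v" "u \<le> v + b" for u v
    proof -
      have "u powr a \<le> (v + b) powr a" using that a by (intro powr_mono2) auto
      also have "\<dots> \<le> v powr a + b powr a" using that b a True by (intro powr_add_le_powr) auto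
      finally show ?thesis .
    qed
    have "x \<le> y + b" "y \<le> x + b" using xy by linarith+
    then have "\<bar>x powr a - y powr a\<bar> \<le> b powr a" using sub[of x y] sub[of y x] xy by auto
    also have "\<dots> \<le> 1 * (b powr a + b powr (a - \<beta>) * y powr \<beta>)" by simp
    also have "\<dots> \<le> (1 + a * 2 powr (a - 1)) * (b powr a + b powr (a - \<beta>) * y powr \<beta>)"
      using a by (intro rhs) auto
    finally show ?thesis .
  next
    case False
    have lip: "u powr a - v powr a \<le> a * b * (y + b) powr (a - 1)"
      if "0 \<le> v" "v \<le> u" "u \<le> v + b" "u \<le> y + b" for u v
    proof -
      have "u powr a - v powr a \<le> a * (u - v) * u powr (a - 1)" using that False by (intro powr_diff_le) auto
      also have "\<dots> \<le> a * b * (y + b) powr (a - 1)"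
        using that False b by (intro mult_mono powr_mono2) auto
      finally show ?thesis .
    qed
    have "\<bar>x powr a - y powr a\<bar> \<le> a * b * (y + b) powr (a - 1)"
    proof (cases "x \<le> y")
      case True
      then have "x powr a \<le> y powr a" using xy a by (intro powr_mono2) auto
      then show ?thesis using lip[of x y] True xy by auto
    next
      case False
      then have "y powr a \<le> x powr a" using xy a by (intro powr_mono2) auto
      then show ?thesis using lip[of y x] False xy by auto
    qed
    also have "a * b * (y + b) powr (a - 1) \<le> a * 2 powr (a - 1) * (b powr a + b powr (a - \<beta>) * y powr \<beta>)"
    proof (cases "y \<le> b")
      case True
      then have "(y + b) powr (a - 1) \<le> (2 * b) powr (a - 1)" using xy b False by (intro powr_mono2) auto
      also have "\<dots> = 2 powr (a - 1) * b powr (a - 1)" using b by (simp add: powr_mult)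
      finally have "a * b * (y + b) powr (a - 1) \<le> a * b * (2 powr (a - 1) * b powr (a - 1))"
        using False b by (intro mult_left_mono) auto
      also have "\<dots> = a * 2 powr (a - 1) * b powr a"
        using b by (cases "b = 0") (auto simp: powr_diff)
      also have "\<dots> \<le> a * 2 powr (a - 1) * (b powr a + b powr (a - \<beta>) * y powr \<beta>)"
        using False by (intro mult_left_mono) auto
      finally show ?thesis .
    next
      case yb: False
      show ?thesis
      proof (cases "b = 0")
        case False': False
        then have pos: "b > 0" "y > 0" using b yb by auto
        have "(y + b) powr (a - 1) \<le> (2 * y) powr (a - 1)" using xy b False yb by (intro powr_mono2) auto
        also have "\<dots> = 2 powr (a - 1) * y powr (a - 1)" using pos by (simp add: powr_mult)
        finally have "a * b * (y + b) powr (a - 1) \<le> a * b * (2 powr (a - 1) * y powr (a - 1))"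
          using False b by (intro mult_left_mono) auto
        also have "\<dots> = a * 2 powr (a - 1) * (b powr (a - \<beta>) * (b powr (1 - a + \<beta>) * y powr (a - 1)))"
        proof -
          have "b powr (a - \<beta>) * b powr (1 - a + \<beta>) = b" using pos by (simp add: powr_add[symmetric])
          then have eq: "b powr (a - \<beta>) * (b powr (1 - a + \<beta>) * y powr (a - 1)) = b * y powr (a - 1)"
            by (simp add: mult.assoc[symmetric])
          show ?thesis unfolding eq by (simp only: mult_ac)
        qed
        also have "\<dots> \<le> a * 2 powr (a - 1) * (b powr (a - \<beta>) * (y powr (1 - a + \<beta>) * y powr (a - 1)))"
          using False yb pos a by (intro mult_left_mono mult_right_mono powr_mono2) auto
        also have "\<dots> = a * 2 powr (a - 1) * (b powr (a - \<beta>) * y powr \<beta>)"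
          by (simp add: powr_add[symmetric])
        also have "\<dots> \<le> a * 2 powr (a - 1) * (b powr a + b powr (a - \<beta>) * y powr \<beta>)"
          using False by (intro mult_left_mono) auto
        finally show ?thesis .
      qed (use False in auto)
    qed
    also have "\<dots> \<le> (1 + a * 2 powr (a - 1)) * (b powr a + b powr (a - \<beta>) * y powr \<beta>)"
      by (rule rhs) simp
    finally show ?thesis .
  qed
qed

text \<open>Split by whether y \<le> e x. The first coefficient can be brought as close to 1 as
  desired, which preserves a strict contraction.\<close>

lemma add_powr_le_weighted:
  fixes x y e p :: real
  assumes "0 \<le> x" "0 \<le> y" "0 < e" "0 < p"
  shows "(x + y) powr p \<le> (1 + e) powr p * x powr p + (1 + 1 / e) powr p * y powr p"
proof (cases "y \<le> e * x")
  case True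
  then have "(x + y) powr p \<le> ((1 + e) * x) powr p" using assms by (intro powr_mono2) (auto simp: algebra_simps)
  also have "\<dots> = (1 + e) powr p * x powr p" using assms by (simp add: powr_mult)
  finally show ?thesis by (simp add: add_increasing2)
next
  case False
  then have "x \<le> y / e" using assms by (simp add: field_simps)
  then have "(x + y) powr p \<le> ((1 + 1 / e) * y) powr p" using assms by (intro powr_mono2) (auto simp: algebra_simps)
  also have "\<dots> = (1 + 1 / e) powr p * y powr p" using assms by (subst powr_mult) auto
  finally show ?thesis by (simp add: add_increasing)
qed

section \<open>Moments of the multiplier and of the stationary law\<close>

lemma integrable_powr_less:
  fixes f :: "'a \<Rightarrow> real"
  assumes "prob_space M" "integrable M (\<lambda>x. f x powr a)" "\<And>x. 0 \<le> f x" "0 < p" "p \<le> a"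
    and [measurable]: "f \<in> borel_measurable M"
  shows "integrable M (\<lambda>x. f x powr p)"
proof -
  interpret prob_space M by fact
  show ?thesis
  proof (rule Bochner_Integration.integrable_bound)
    show "integrable M (\<lambda>x. 1 + f x powr a)" using assms by auto
    have "f x powr p \<le> 1 + f x powr a" for x
    proof (cases "f x \<le> 1")
      case True
      then have "f x powr p \<le> 1" using assms by (intro powr_le1) auto
      then show ?thesis by (simp add: add_increasing2)
    next
      case False
      then have "f x powr p \<le> f x powr a" using assms by (intro powr_mono) auto
      then show ?thesis by simp
    qed
    then show "AE x in M. norm (f x powr p) \<le> norm (1 + f x powr a)" by auto
  qed measurable
qed

text \<open>Strict Jensen inequality: the gap \<open>D\<close> in the tangent bound at
  \<open>A powr a\<close> is nonnegative with mean 1 - E A^p. If that mean were not positive,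
  \<open>D\<close> would vanish almost surely, and the equality case would give
  \<open>A = 1\<close>.\<close>

lemma lower_moment_less_1:
  fixes A :: "'a \<Rightarrow> real"
  assumes "prob_space M" and [measurable]: "A \<in> borel_measurable M" and pos: "\<And>x. 0 < A x"
    and A: "integrable M (\<lambda>x. A x powr a)" "(\<integral>x. A x powr a \<partial>M) = 1"
    and p: "0 < p" "p < a" and ne: "\<not> (AE x in M. A x = 1)"
  shows "(\<integral>x. A x powr p \<partial>M) < 1"
proof (rule ccontr)
  interpret prob_space M by fact
  define c where "c = p / a"
  have c: "0 < c" "c < 1" using p by (auto simp: c_def)
  have pc: "A x powr p = (A x powr a) powr c" for x using p by (simp add: c_def powr_powr)
  have int: "integrable M (\<lambda>x. A x powr p)"
    by (rule integrable_powr_less[OF assms(1) A(1)]) (use pos p in \<open>auto intro: less_imp_le\<close>)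
  assume "\<not> (\<integral>x. A x powr p \<partial>M) < 1"
  then have ge: "1 \<le> (\<integral>x. A x powr p \<partial>M)" by simp
  define D where "D x = c * A x powr a + (1 - c) - A x powr p" for x
  have D: "0 \<le> D x" for x using powr_le_affine[of "A x powr a" c] c by (simp add: D_def pc)
  have D_int: "integrable M D" unfolding D_def using int A by auto
  have "(\<integral>x. D x \<partial>M) = 1 - (\<integral>x. A x powr p \<partial>M)"
    unfolding D_def using int A by (simp add: prob_space)
  moreover have "0 \<le> (\<integral>x. D x \<partial>M)" using D by simp
  ultimately have "(\<integral>x. D x \<partial>M) = 0" using ge by simp
  then have "AE x in M. D x = 0" using integral_nonneg_eq_0_iff_AE[OF D_int] D by simp
  then have "AE x in M. A x = 1"
  proof eventually_elim
    case (elim x)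
    then have "(A x powr a) powr c = c * A x powr a + (1 - c)" by (simp add: D_def pc)
    then have "A x powr a = 1" using pos[of x] c by (intro powr_eq_affine) auto
    then have "ln (A x powr a) = 0" by simp
    then show ?case using pos[of x] p by (simp add: ln_powr)
  qed
  with ne show False by simp
qed

text \<open>In the truncated moment $E \min(Y, n)^p$ the contribution of $\{Y > n\}$ is at most $n^p P[Y > n]$ on
  both sides of the stationarity equation and cancels, leaving a contraction for $E[Y^p; Y \le n]$.\<close>

lemma stationary_moment:
  fixes P :: "'a measure" and N :: "'b measure" and A B :: "'a \<Rightarrow> real" and Y :: "'b \<Rightarrow> real"
    and Y' :: "'a \<times> 'b \<Rightarrow> real"
  assumes P: "prob_space P" and N: "prob_space N"
    and [measurable]: "A \<in> borel_measurable P" "B \<in> borel_measurable P"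
    and A_nonneg: "\<And>\<theta>. 0 \<le> A \<theta>" and B_nonneg: "\<And>\<theta>. 0 \<le> B \<theta>" and p: "0 < p"
    and A_int: "integrable P (\<lambda>\<theta>. A \<theta> powr p)" "(\<integral>\<theta>. A \<theta> powr p \<partial>P) < 1"
    and B_int: "integrable P (\<lambda>\<theta>. B \<theta> powr p)"
    and [measurable]: "Y \<in> borel_measurable N" "Y' \<in> borel_measurable (P \<Otimes>\<^sub>M N)"
    and Y_nonneg: "\<And>x. 0 \<le> Y x" and Y'_nonneg: "\<And>x. 0 \<le> Y' x"
    and law: "distr (P \<Otimes>\<^sub>M N) borel Y' = distr N borel Y"
    and le: "AE z in P \<Otimes>\<^sub>M N. Y' z \<le> A (fst z) * Y (snd z) + B (fst z)"
  shows "integrable N (\<lambda>x. Y x powr p)"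
proof -
  interpret P: prob_space P by fact
  interpret N: prob_space N by fact
  interpret PN: pair_prob_space P N ..
  define \<rho> where "\<rho> = (\<integral>\<theta>. A \<theta> powr p \<partial>P)"
  \<comment> \<open>The weight \<open>e\<close> is taken so small that \<open>(1 + e) powr p\<close>
    does not spoil the contraction.\<close>
  have "((\<lambda>e. (1 + e) powr p * \<rho>) \<longlongrightarrow> (1 + 0) powr p * \<rho>) (at_right 0)"
    by (intro tendsto_intros) auto
  then have "\<forall>\<^sub>F e in at_right 0. (1 + e) powr p * \<rho> < 1"
    using A_int by (auto simp: \<rho>_def intro!: order_tendstoD(2))
  then have "\<forall>\<^sub>F e in at_right 0. (1 + e) powr p * \<rho> < 1 \<and> 0 < e"
    using eventually_at_right_less by (rule eventually_conj)
  then have "\<exists>e. (1 + e) powr p * \<rho> < 1 \<and> 0 < e" by (rule eventually_happens'[rotated]) simp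
  then obtain e where e: "(1 + e) powr p * \<rho> < 1" "0 < e" by blast
  define \<kappa> where "\<kappa> = (1 + e) powr p * \<rho>"
  define D where "D = (1 + 1 / e) powr p * (\<integral>\<theta>. B \<theta> powr p \<partial>P)"
  \<comment> \<open>For each n, \<open>I n x + J n x\<close> is the p-th power of
    \<open>min (Y x) n\<close>, split according to whether the truncation acts.\<close>
  define I where "I n x = Y x powr p * of_bool (Y x \<le> real n)" for n x
  define J where "J n x = real n powr p * of_bool (\<not> Y x \<le> real n)" for n x
  have [measurable]: "I n \<in> borel_measurable N" "J n \<in> borel_measurable N" for n
    unfolding I_def[abs_def] J_def[abs_def] by measurable
  have I_int: "integrable N (I n)" for n
    by (rule N.integrable_const_bound[of _ "real n powr p"])
       (use Y_nonneg p in \<open>auto simp: I_def intro!: powr_mono2\<close>)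
  have J_int: "integrable N (J n)" for n
    by (rule N.integrable_const_bound[of _ "real n powr p"]) (auto simp: J_def)
  have bound: "(\<integral>x. I n x \<partial>N) \<le> D / (1 - \<kappa>)" for n
  proof -
    define \<phi> where "\<phi> y = (min y (real n)) powr p" for y
    have [measurable]: "\<phi> \<in> borel_measurable borel" unfolding \<phi>_def by measurable
    have "(\<integral>x. \<phi> (Y x) \<partial>N) = (\<integral>y. \<phi> y \<partial>distr N borel Y)" by (simp add: integral_distr)
    also have "\<dots> = (\<integral>z. \<phi> (Y' z) \<partial>(P \<Otimes>\<^sub>M N))" unfolding law[symmetric] by (simp add: integral_distr)
    also have "\<dots> \<le> (\<integral>z. (1 + e) powr p * (case z of (\<theta>, x) \<Rightarrow> A \<theta> powr p * I n x)
        + ((1 + 1 / e) powr p * (case z of (\<theta>, x) \<Rightarrow> B \<theta> powr p * 1)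
        + (case z of (\<theta>, x) \<Rightarrow> 1 * J n x)) \<partial>(P \<Otimes>\<^sub>M N))"
    proof (rule integral_mono_AE)
      show "integrable (P \<Otimes>\<^sub>M N) (\<lambda>z. \<phi> (Y' z))"
        by (rule PN.integrable_const_bound[of _ "real n powr p"])
           (use Y'_nonneg p in \<open>auto simp: \<phi>_def intro!: powr_mono2\<close>)
      show "integrable (P \<Otimes>\<^sub>M N) (\<lambda>z. (1 + e) powr p * (case z of (\<theta>, x) \<Rightarrow> A \<theta> powr p * I n x)
        + ((1 + 1 / e) powr p * (case z of (\<theta>, x) \<Rightarrow> B \<theta> powr p * 1)
        + (case z of (\<theta>, x) \<Rightarrow> 1 * J n x)))"
        by (intro Bochner_Integration.integrable_add integrable_mult_right PN.integrable_pair_mult A_int B_int I_int J_int) auto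
      show "AE z in P \<Otimes>\<^sub>M N. \<phi> (Y' z) \<le> (1 + e) powr p * (case z of (\<theta>, x) \<Rightarrow> A \<theta> powr p * I n x)
        + ((1 + 1 / e) powr p * (case z of (\<theta>, x) \<Rightarrow> B \<theta> powr p * 1)
        + (case z of (\<theta>, x) \<Rightarrow> 1 * J n x))"
        using le
      proof eventually_elim
        case (elim z)
        obtain \<theta> x where z: "z = (\<theta>, x)" by (cases z)
        show ?case
        proof (cases "Y x \<le> real n")
          case True
          have "\<phi> (Y' z) \<le> (A \<theta> * Y x + B \<theta>) powr p"
            unfolding \<phi>_def using elim Y'_nonneg p by (intro powr_mono2) (auto simp: z)
          also have "\<dots> \<le> (1 + e) powr p * (A \<theta> * Y x) powr p + (1 + 1 / e) powr p * B \<theta> powr p"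
            using A_nonneg Y_nonneg B_nonneg e p by (intro add_powr_le_weighted) auto
          finally show ?thesis using True A_nonneg Y_nonneg by (simp add: z I_def J_def powr_mult)
        next
          case False
          have "\<phi> (Y' z) \<le> real n powr p" unfolding \<phi>_def using Y'_nonneg p by (intro powr_mono2) auto
          then show ?thesis using False by (simp add: z I_def J_def add_increasing)
        qed
      qed
    qed
    also have "\<dots> = \<kappa> * (\<integral>x. I n x \<partial>N) + (D + (\<integral>x. J n x \<partial>N))"
    proof -
      have 1: "integrable (P \<Otimes>\<^sub>M N) (\<lambda>(\<theta>, x). A \<theta> powr p * I n x)"
        "(\<integral>(\<theta>, x). A \<theta> powr p * I n x \<partial>(P \<Otimes>\<^sub>M N)) = \<rho> * (\<integral>x. I n x \<partial>N)"
        unfolding \<rho>_def using PN.pair_integral_mult[OF A_int(1) I_int[of n]] by auto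
      have 2: "integrable (P \<Otimes>\<^sub>M N) (\<lambda>(\<theta>, x). B \<theta> powr p * 1)"
        "(\<integral>(\<theta>, x). B \<theta> powr p * 1 \<partial>(P \<Otimes>\<^sub>M N)) = (\<integral>\<theta>. B \<theta> powr p \<partial>P) * 1"
        using PN.pair_integral_mult[OF B_int, of "\<lambda>_. 1"] N.prob_space by auto
      have 3: "integrable (P \<Otimes>\<^sub>M N) (\<lambda>(\<theta>, x). 1 * J n x)"
        "(\<integral>(\<theta>, x). 1 * J n x \<partial>(P \<Otimes>\<^sub>M N)) = 1 * (\<integral>x. J n x \<partial>N)"
        using PN.pair_integral_mult[of "\<lambda>_. 1", OF _ J_int[of n]] P.prob_space by auto
      have "(\<integral>z. (1 + e) powr p * (case z of (\<theta>, x) \<Rightarrow> A \<theta> powr p * I n x)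
        + ((1 + 1 / e) powr p * (case z of (\<theta>, x) \<Rightarrow> B \<theta> powr p * 1)
        + (case z of (\<theta>, x) \<Rightarrow> 1 * J n x)) \<partial>(P \<Otimes>\<^sub>M N))
        = (1 + e) powr p * (\<integral>(\<theta>, x). A \<theta> powr p * I n x \<partial>(P \<Otimes>\<^sub>M N))
        + ((1 + 1 / e) powr p * (\<integral>(\<theta>, x). B \<theta> powr p * 1 \<partial>(P \<Otimes>\<^sub>M N))
        + (\<integral>(\<theta>, x). 1 * J n x \<partial>(P \<Otimes>\<^sub>M N)))"
        using 1(1) 2(1) 3(1)
        by (subst Bochner_Integration.integral_add; (intro Bochner_Integration.integrable_add integrable_mult_right)?)+
           auto
      then show ?thesis unfolding 1 2 3 by (simp add: \<kappa>_def D_def)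
    qed
    finally have "(\<integral>x. \<phi> (Y x) \<partial>N) \<le> \<kappa> * (\<integral>x. I n x \<partial>N) + (D + (\<integral>x. J n x \<partial>N))" .
    moreover have "(\<integral>x. \<phi> (Y x) \<partial>N) = (\<integral>x. I n x \<partial>N) + (\<integral>x. J n x \<partial>N)"
      unfolding Bochner_Integration.integral_add[OF I_int J_int, symmetric]
      by (intro Bochner_Integration.integral_cong) (auto simp: \<phi>_def I_def J_def)
    ultimately have "(1 - \<kappa>) * (\<integral>x. I n x \<partial>N) \<le> D" by (simp add: algebra_simps)
    then show ?thesis using e by (simp add: \<kappa>_def field_simps)
  qed
  have I_mono: "I m x \<le> I n x" if "m \<le> n" for m n x
    using that by (auto simp: I_def)
  have incr: "incseq (\<lambda>n. \<integral>x. I n x \<partial>N)"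
    by (intro incseq_SucI integral_mono I_int I_mono) simp
  then obtain l where l: "(\<lambda>n. \<integral>x. I n x \<partial>N) \<longlonglongrightarrow> l"
    using incseq_convergent[OF incr] bound by metis
  show ?thesis
  proof (rule integrable_monotone_convergence[OF I_int _ _ l])
    show "AE x in N. mono (\<lambda>n. I n x)" by (intro AE_I2 monoI I_mono)
    show "AE x in N. (\<lambda>n. I n x) \<longlonglongrightarrow> Y x powr p"
    proof (rule AE_I2)
      fix x
      obtain k where "Y x \<le> real k" using real_arch_simple by blast
      then have "\<forall>\<^sub>F n in sequentially. I n x = Y x powr p"
        unfolding eventually_sequentially by (intro exI[of _ k]) (auto simp: I_def)
      then show "(\<lambda>n. I n x) \<longlonglongrightarrow> Y x powr p" by (rule tendsto_eventually)
    qed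
  qed measurable
qed

section \<open>Existence and positivity of the tail constant\<close>

theorem stationary_tail:
  fixes P :: "'a measure" and N :: "'b measure" and A B :: "'a \<Rightarrow> real" and Y :: "'b \<Rightarrow> real"
    and Y' :: "'a \<times> 'b \<Rightarrow> real" and a :: real
  assumes P: "prob_space P" and N: "prob_space N"
    and A_meas [measurable]: "A \<in> borel_measurable P" and A_pos: "\<And>\<theta>. 0 < A \<theta>"
    and B_meas [measurable]: "B \<in> borel_measurable P" and B_nonneg: "\<And>\<theta>. 0 \<le> B \<theta>"
    and a: "0 < a"
    and A_int: "integrable P (\<lambda>\<theta>. A \<theta> powr a)" "(\<integral>\<theta>. A \<theta> powr a \<partial>P) = 1"
    and A_log: "integrable P (\<lambda>\<theta>. A \<theta> powr a * ln (A \<theta>))"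
    and B_int: "integrable P (\<lambda>\<theta>. B \<theta> powr a)"
    and nonarith: "\<not> (\<exists>c>0. AE \<theta> in P. ln (A \<theta>) \<in> {c * of_int k | k. True})"
    and Y_meas [measurable]: "Y \<in> borel_measurable N" and Y_nonneg: "\<And>x. 0 \<le> Y x"
    and Y'_meas [measurable]: "Y' \<in> borel_measurable (P \<Otimes>\<^sub>M N)" and Y'_nonneg: "\<And>x. 0 \<le> Y' x"
    and law: "distr (P \<Otimes>\<^sub>M N) borel Y' = distr N borel Y"
    and close: "AE z in P \<Otimes>\<^sub>M N. \<bar>Y' z - A (fst z) * Y (snd z)\<bar> \<le> B (fst z)"
  obtains C where "((\<lambda>t. t powr a * measure N {x \<in> space N. t < Y x}) \<longlongrightarrow> C) at_top"
    and "(\<And>K. measure N {x \<in> space N. K < Y x} > 0) \<Longrightarrow> C > 0"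
proof -
  interpret P: prob_space P by fact
  interpret N: prob_space N by fact
  interpret PN: pair_prob_space P N ..
  \<comment> \<open>The exponent must be positive, below \<open>a\<close>, and at least
    \<open>a - 1\<close> for \<open>abs_powr_diff_le\<close>.\<close>
  define \<beta> where "\<beta> = max (a / 2) (a - 1)"
  have \<beta>: "0 < \<beta>" "\<beta> < a" "a - 1 \<le> \<beta>" using a by (auto simp: \<beta>_def)
  have A_nonneg: "0 \<le> A \<theta>" for \<theta> using A_pos[of \<theta>] by simp
  have A_\<beta>: "integrable P (\<lambda>\<theta>. A \<theta> powr \<beta>)"
    by (rule integrable_powr_less[OF P A_int(1)]) (use A_nonneg \<beta> in auto)
  have B_\<beta>: "integrable P (\<lambda>\<theta>. B \<theta> powr \<beta>)"
    by (rule integrable_powr_less[OF P B_int]) (use B_nonneg \<beta> in auto)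
  have A_ne: "\<not> (AE \<theta> in P. A \<theta> = 1)"
  proof
    assume "AE \<theta> in P. A \<theta> = 1"
    then have "AE \<theta> in P. ln (A \<theta>) \<in> {1 * of_int k | k. True}"
      by eventually_elim (auto intro: exI[of _ 0])
    with nonarith show False by (meson zero_less_one)
  qed
  define \<rho> where "\<rho> = (\<integral>\<theta>. A \<theta> powr \<beta> \<partial>P)"
  have \<rho>: "\<rho> < 1"
    unfolding \<rho>_def by (rule lower_moment_less_1[OF P A_meas A_pos A_int \<beta>(1,2) A_ne])
  have le: "AE z in P \<Otimes>\<^sub>M N. Y' z \<le> A (fst z) * Y (snd z) + B (fst z)"
    using close by eventually_elim auto
  have Y_\<beta>: "integrable N (\<lambda>x. Y x powr \<beta>)"
    by (rule stationary_moment[OF P N A_meas B_meas A_nonneg B_nonneg \<beta>(1) A_\<beta> _ B_\<beta> Y_meas Y'_meas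
          Y_nonneg Y'_nonneg law le]) (use \<rho> in \<open>simp add: \<rho>_def\<close>)
  have Y'_\<beta>: "integrable (P \<Otimes>\<^sub>M N) (\<lambda>z. Y' z powr \<beta>)"
  proof -
    have "integrable (distr N borel Y) (\<lambda>y. y powr \<beta>)"
      using Y_\<beta> by (simp add: integrable_distr_eq)
    then show ?thesis unfolding law[symmetric] by (simp add: integrable_distr_eq)
  qed
  define c where "c = 1 + a * 2 powr (a - 1)"
  have c: "0 \<le> c" using a by (simp add: c_def)
  \<comment> \<open>\<open>M\<close> is the random coefficient of Y^\<beta> in the error; its
    exponents add up to \<open>a\<close>, so \<open>powr_mult_le_add\<close> makes it
    integrable.\<close>
  define M where "M \<theta> = B \<theta> powr (a - \<beta>) * A \<theta> powr \<beta>" for \<theta>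
  have M_nonneg: "0 \<le> M \<theta>" for \<theta> by (simp add: M_def)
  have M_int: "integrable P M"
  proof (rule Bochner_Integration.integrable_bound)
    show "integrable P (\<lambda>\<theta>. B \<theta> powr a + A \<theta> powr a)" using A_int B_int by auto
    show "AE \<theta> in P. norm (M \<theta>) \<le> norm (B \<theta> powr a + A \<theta> powr a)"
      using powr_mult_le_add[OF B_nonneg A_nonneg, of "a - \<beta>" \<beta>] \<beta> by (simp add: M_def)
    show "M \<in> borel_measurable P" unfolding M_def by measurable
  qed
  have powr_close: "AE z in P \<Otimes>\<^sub>M N. \<bar>Y' z powr a - (A (fst z) * Y (snd z)) powr a\<bar>
      \<le> c * (B (fst z) powr a + M (fst z) * Y (snd z) powr \<beta>)"
    using close
  proof eventually_elim
    case (elim z)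
    have "\<bar>Y' z powr a - (A (fst z) * Y (snd z)) powr a\<bar>
      \<le> c * (B (fst z) powr a + B (fst z) powr (a - \<beta>) * (A (fst z) * Y (snd z)) powr \<beta>)"
      unfolding c_def using elim \<beta> Y'_nonneg A_nonneg Y_nonneg by (intro abs_powr_diff_le) auto
    then show ?case using A_nonneg Y_nonneg by (simp add: M_def powr_mult mult.assoc)
  qed
  have B_pair: "integrable (P \<Otimes>\<^sub>M N) (\<lambda>z. B (fst z) powr a)"
    using PN.integrable_pair_mult[OF B_int, of "\<lambda>_. 1"] by (simp add: case_prod_unfold)
  have M_pair: "integrable (P \<Otimes>\<^sub>M N) (\<lambda>z. M (fst z) * Y (snd z) powr \<beta>)"
    using PN.integrable_pair_mult[OF M_int Y_\<beta>] by (simp add: case_prod_unfold)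
  have A_pair: "integrable (P \<Otimes>\<^sub>M N) (\<lambda>z. A (fst z) powr a * Y (snd z) powr \<beta>)"
    using PN.integrable_pair_mult[OF A_int(1) Y_\<beta>] by (simp add: case_prod_unfold)
  have diff_int: "integrable (P \<Otimes>\<^sub>M N) (\<lambda>z. Y' z powr a - (A (fst z) * Y (snd z)) powr a)"
  proof (rule Bochner_Integration.integrable_bound)
    show "integrable (P \<Otimes>\<^sub>M N) (\<lambda>z. c * (B (fst z) powr a + M (fst z) * Y (snd z) powr \<beta>))"
      using B_pair M_pair by auto
    show "AE z in P \<Otimes>\<^sub>M N. norm (Y' z powr a - (A (fst z) * Y (snd z)) powr a)
        \<le> norm (c * (B (fst z) powr a + M (fst z) * Y (snd z) powr \<beta>))"
      using powr_close by eventually_elim (auto intro: order_trans[OF _ abs_ge_self])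
  qed measurable
  have tail_law: "measure (P \<Otimes>\<^sub>M N) {z \<in> space (P \<Otimes>\<^sub>M N). t < f (Y' z)} = measure N {x \<in> space N. t < f (Y x)}"
    if [measurable]: "f \<in> borel_measurable borel" for f :: "real \<Rightarrow> real" and t
  proof -
    have "measure (distr (P \<Otimes>\<^sub>M N) borel Y') {y. t < f y} = measure (distr N borel Y) {y. t < f y}"
      by (simp add: law)
    then show ?thesis by (simp add: measure_distr vimage_def Int_def conj_commute)
  qed
  define m where "m = (\<integral>\<theta>. A \<theta> powr a * ln (A \<theta>) \<partial>P)"
  define C where "C = (\<integral>z. Y' z powr a - (A (fst z) * Y (snd z)) powr a \<partial>(P \<Otimes>\<^sub>M N)) / (a * m)"
  have A_\<beta>1: "(\<integral>\<theta>. A \<theta> powr \<beta> \<partial>P) < 1" using \<rho> by (simp add: \<rho>_def)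
  note renewal = implicit_renewal[OF P N A_meas A_pos \<beta>(1,2) A_int A_\<beta> A_\<beta>1 A_log nonarith]
  have m: "m > 0" and lim: "((\<lambda>t. t powr a * measure N {x \<in> space N. t < Y x}) \<longlongrightarrow> C) at_top"
    unfolding m_def C_def
    using renewal[OF Y_meas Y_nonneg Y_\<beta> Y'_meas Y'_nonneg tail_law[of "\<lambda>y. y", simplified] diff_int] by auto
  have "C > 0" if unbdd: "\<And>K. measure N {x \<in> space N. K < Y x} > 0"
  proof -
    define E where "E = (\<integral>\<theta>. B \<theta> powr a \<partial>P) + (\<integral>\<theta>. M \<theta> \<partial>P)"
    \<comment> \<open>The gain \<open>D * (1 - \<rho>)\<close> is to exceed the mean error
      coefficient \<open>c * E\<close> by at least 1.\<close>
    define D where "D = max 1 ((c * E + 1) / (1 - \<rho>))"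
    have D: "1 \<le> D" by (simp add: D_def)
    have "(c * E + 1) / (1 - \<rho>) \<le> D" by (simp add: D_def)
    then have D_large: "c * E + 1 \<le> D * (1 - \<rho>)" using \<rho> by (simp add: field_simps)
    define u where "u y = max 0 (y powr a - D * y powr \<beta>)" for y
    have [measurable]: "u \<in> borel_measurable borel" unfolding u_def by measurable
    have factor: "y powr a - D * y powr \<beta> = y powr \<beta> * (y powr (a - \<beta>) - D)" if "0 \<le> y" for y
      using that by (cases "y = 0") (auto simp: algebra_simps powr_add[symmetric])
    have u_nonneg: "0 \<le> u y" for y by (simp add: u_def)
    have u_le: "u y \<le> y powr a" for y using D by (simp add: u_def)
    \<comment> \<open>Where \<open>u\<close> is positive it is a product of two nonnegative
      increasing functions.\<close>
    have u_mono: "u x \<le> u y" if "0 \<le> x" "x \<le> y" for x y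
    proof (cases "x powr (a - \<beta>) \<le> D")
      case True
      then have "x powr a - D * x powr \<beta> \<le> 0" using that by (simp add: factor mult_nonneg_nonpos)
      then have "u x = 0" by (simp add: u_def)
      then show ?thesis using u_nonneg by simp
    next
      case False
      have "x powr \<beta> \<le> y powr \<beta>" "x powr (a - \<beta>) \<le> y powr (a - \<beta>)"
        using that \<beta> by (auto intro!: powr_mono2)
      then have "x powr \<beta> * (x powr (a - \<beta>) - D) \<le> y powr \<beta> * (y powr (a - \<beta>) - D)"
        using False by (intro mult_mono) auto
      then show ?thesis using that by (simp add: u_def factor max_def)
    qed
    \<comment> \<open>The root makes \<open>\<psi> y powr a\<close> equal to \<open>u y\<close>, so
      the implicit renewal theorem for \<open>\<psi> (Y x)\<close> yields the mean of u(Y') - A^a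
      u(Y).\<close>
    define \<psi> where "\<psi> y = u y powr (1 / a)" for y
    have \<psi>_meas [measurable]: "\<psi> \<in> borel_measurable borel" unfolding \<psi>_def by measurable
    have \<psi>_nonneg: "0 \<le> \<psi> y" for y by (simp add: \<psi>_def)
    have \<psi>_pow: "\<psi> y powr a = u y" for y using a u_nonneg[of y] by (simp add: \<psi>_def powr_powr)
    have \<psi>_le: "\<psi> y \<le> y" if "0 \<le> y" for y
    proof -
      have "u y powr (1 / a) \<le> (y powr a) powr (1 / a)" using u_le u_nonneg a by (intro powr_mono2) auto
      then show ?thesis using that a by (simp add: \<psi>_def powr_powr)
    qed
    have Z_\<beta>: "integrable N (\<lambda>x. \<psi> (Y x) powr \<beta>)"
      by (rule Bochner_Integration.integrable_bound[OF Y_\<beta>])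
         (use \<psi>_le \<psi>_nonneg Y_nonneg \<beta> in \<open>auto intro!: AE_I2 powr_mono2\<close>)
    have AZ: "(A \<theta> * \<psi> (Y x)) powr a = A \<theta> powr a * u (Y x)" for \<theta> x
      using A_nonneg \<psi>_nonneg by (simp add: powr_mult \<psi>_pow)
    have AuY: "A \<theta> powr a * u (Y x) = max 0 ((A \<theta> * Y x) powr a - D * (A \<theta> powr a * Y x powr \<beta>))" for \<theta> x
      using A_nonneg Y_nonneg by (simp add: u_def powr_mult max_mult_distrib_left right_diff_distrib mult.left_commute)
    \<comment> \<open>The positive part is 1-Lipschitz, so the difference is bounded by that of the
      leading powers plus both corrections, and the corrections contain only the integrable power
      \<beta>.\<close>
    have Zdiff: "integrable (P \<Otimes>\<^sub>M N) (\<lambda>z. \<psi> (Y' z) powr a - (A (fst z) * \<psi> (Y (snd z))) powr a)"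
    proof (rule Bochner_Integration.integrable_bound)
      show "integrable (P \<Otimes>\<^sub>M N) (\<lambda>z. \<bar>Y' z powr a - (A (fst z) * Y (snd z)) powr a\<bar> + (D * Y' z powr \<beta>
          + D * (A (fst z) powr a * Y (snd z) powr \<beta>)))"
        by (intro Bochner_Integration.integrable_add integrable_abs integrable_mult_right diff_int Y'_\<beta> A_pair)
      show "AE z in P \<Otimes>\<^sub>M N. norm (\<psi> (Y' z) powr a - (A (fst z) * \<psi> (Y (snd z))) powr a)
        \<le> norm (\<bar>Y' z powr a - (A (fst z) * Y (snd z)) powr a\<bar> + (D * Y' z powr \<beta>
          + D * (A (fst z) powr a * Y (snd z) powr \<beta>)))"
      proof (rule AE_I2)
        fix z
        have max_diff: "\<bar>max 0 (p - q) - max 0 (p' - q')\<bar> \<le> \<bar>p - p'\<bar> + (q + q')" if "0 \<le> q" "0 \<le> q'" for p q p' q' :: real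
          using that by (auto simp: max_def)
        have "0 \<le> D * Y' z powr \<beta>" "0 \<le> D * (A (fst z) powr a * Y (snd z) powr \<beta>)" using D by auto
        then show "norm (\<psi> (Y' z) powr a - (A (fst z) * \<psi> (Y (snd z))) powr a)
          \<le> norm (\<bar>Y' z powr a - (A (fst z) * Y (snd z)) powr a\<bar> + (D * Y' z powr \<beta>
            + D * (A (fst z) powr a * Y (snd z) powr \<beta>)))"
          unfolding \<psi>_pow AZ AuY unfolding u_def real_norm_def
          by (rule order_trans[OF max_diff abs_ge_self])
      qed
    qed measurable
    define C' where "C' = (\<integral>z. \<psi> (Y' z) powr a - (A (fst z) * \<psi> (Y (snd z))) powr a \<partial>(P \<Otimes>\<^sub>M N)) / (a * m)"
    have lim': "((\<lambda>t. t powr a * measure N {x \<in> space N. t < \<psi> (Y x)}) \<longlongrightarrow> C') at_top"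
      unfolding m_def C'_def
      by (rule renewal(2)[OF _ \<psi>_nonneg Z_\<beta> _ \<psi>_nonneg tail_law[OF \<psi>_meas] Zdiff]) measurable
    \<comment> \<open>$k$ and $l$ come from inserting the lower bound $AY - B$ into $u$ and using $Y \ge 1$ where $u(Y) > 0$.\<close>
    define k where "k \<theta> = D * A \<theta> powr a - D * A \<theta> powr \<beta> - c * (B \<theta> powr a + M \<theta>)" for \<theta>
    define l where "l x = Y x powr \<beta> * of_bool (D < Y x powr (a - \<beta>))" for x
    have k_int: "integrable P k" unfolding k_def using A_int A_\<beta> B_int M_int by auto
    have k_ge: "1 \<le> (\<integral>\<theta>. k \<theta> \<partial>P)"
    proof -
      have "(\<integral>\<theta>. k \<theta> \<partial>P) = D * 1 - D * \<rho> - c * E"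
        unfolding k_def E_def using A_int A_\<beta> B_int M_int by (simp add: \<rho>_def)
      then show ?thesis using D_large by (simp add: algebra_simps)
    qed
    have l_nonneg: "0 \<le> l x" for x by (simp add: l_def)
    have l_int: "integrable N l"
    proof (rule Bochner_Integration.integrable_bound[OF Y_\<beta>])
      show "l \<in> borel_measurable N" unfolding l_def by measurable
      show "AE x in N. norm (l x) \<le> norm (Y x powr \<beta>)" by (intro AE_I2) (auto simp: l_def)
    qed
    \<comment> \<open>Unboundedness enters here: if \<open>l\<close> vanished almost surely,
      \<open>Y\<close> would be bounded by the threshold above which \<open>u\<close> is
      positive.\<close>
    have l_pos: "0 < (\<integral>x. l x \<partial>N)"
    proof (rule ccontr)
      assume "\<not> 0 < (\<integral>x. l x \<partial>N)"
      moreover have "0 \<le> (\<integral>x. l x \<partial>N)" using l_nonneg by simp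
      ultimately have "(\<integral>x. l x \<partial>N) = 0" by simp
      then have "AE x in N. l x = 0" using integral_nonneg_eq_0_iff_AE[OF l_int] l_nonneg by simp
      then have "AE x in N. \<not> D powr (1 / (a - \<beta>)) < Y x"
      proof eventually_elim
        case (elim x)
        show ?case
        proof
          assume gt: "D powr (1 / (a - \<beta>)) < Y x"
          then have "(D powr (1 / (a - \<beta>))) powr (a - \<beta>) < Y x powr (a - \<beta>)"
            using \<beta> by (intro powr_less_mono2) auto
          then have "D < Y x powr (a - \<beta>)" using \<beta> D by (simp add: powr_powr)
          moreover have "0 < Y x" using gt by (rule le_less_trans[OF powr_ge_zero])
          ultimately show False using elim by (simp add: l_def)
        qed
      qed
      then have "measure N {x \<in> space N. D powr (1 / (a - \<beta>)) < Y x} = 0"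
        by (subst N.prob_eq_0) auto
      with unbdd[of "D powr (1 / (a - \<beta>))"] show False by simp
    qed
    have lower: "AE z in P \<Otimes>\<^sub>M N. k (fst z) * l (snd z) \<le> \<psi> (Y' z) powr a - (A (fst z) * \<psi> (Y (snd z))) powr a"
      using close
    proof eventually_elim
      case (elim z)
      obtain \<theta> x where z: "z = (\<theta>, x)" by (cases z)
      show ?case
      \<comment> \<open>Up to the threshold both \<open>u (Y x)\<close> and \<open>l x\<close>
        vanish, and the claim reduces to nonnegativity of \<open>u\<close>.\<close>
      proof (cases "D < Y x powr (a - \<beta>)")
        case False
        then have "Y x powr a - D * Y x powr \<beta> \<le> 0" using Y_nonneg by (simp add: factor mult_nonneg_nonpos)
        then have "u (Y x) = 0" by (simp add: u_def)
        then show ?thesis using False u_nonneg by (simp add: z \<psi>_pow AZ l_def)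
      next
        case True
        have Y1: "1 \<le> Y x powr \<beta>"
        proof (rule ccontr)
          assume "\<not> 1 \<le> Y x powr \<beta>"
          then have "Y x < 1" using \<beta> ge_one_powr_ge_zero[of "Y x" \<beta>] by (cases "1 \<le> Y x") auto
          then have "Y x powr (a - \<beta>) \<le> 1" using \<beta> Y_nonneg by (intro powr_le1) auto
          with True D show False by simp
        qed
        \<comment> \<open>The lower bound is cut off at 0: it stays within \<open>B\<close> of A Y,
          stays below \<open>Y'\<close>, and lies where \<open>u\<close> is known to be
          monotone.\<close>
        define v where "v = max 0 (A \<theta> * Y x - B \<theta>)"
        have AY: "0 \<le> A \<theta> * Y x" using A_nonneg Y_nonneg by simp
        have v: "0 \<le> v" "v \<le> A \<theta> * Y x" "\<bar>v - A \<theta> * Y x\<bar> \<le> B \<theta>" "v \<le> Y' z"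
          using AY B_nonneg[of \<theta>] elim Y'_nonneg[of z] by (auto simp: v_def z)
        have "\<bar>v powr a - (A \<theta> * Y x) powr a\<bar> \<le> c * (B \<theta> powr a + B \<theta> powr (a - \<beta>) * (A \<theta> * Y x) powr \<beta>)"
          unfolding c_def using v AY \<beta> by (intro abs_powr_diff_le) auto
        then have 1: "(A \<theta> * Y x) powr a - c * (B \<theta> powr a + M \<theta> * Y x powr \<beta>) \<le> v powr a"
          using A_nonneg Y_nonneg by (simp add: M_def powr_mult mult.assoc abs_le_iff)
        have 2: "v powr \<beta> \<le> A \<theta> powr \<beta> * Y x powr \<beta>"
          using v \<beta> powr_mono2[of \<beta> v "A \<theta> * Y x"] A_nonneg Y_nonneg by (simp add: powr_mult)
        \<comment> \<open>Multiplying the error term free of Y by Y^\<beta> \<ge> 1 gives the whole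
          bound the product form k l.\<close>
        have 3: "B \<theta> powr a \<le> B \<theta> powr a * Y x powr \<beta>" using Y1 by (simp add: mult_le_cancel_left1)
        have "A \<theta> powr a * u (Y x) = A \<theta> powr a * (Y x powr a - D * Y x powr \<beta>)"
          using True Y_nonneg by (simp add: u_def factor max_def)
        then have 4: "A \<theta> powr a * u (Y x) = (A \<theta> * Y x) powr a - D * (A \<theta> powr a * Y x powr \<beta>)"
          using A_nonneg Y_nonneg by (simp add: powr_mult right_diff_distrib mult.left_commute)
        have "k \<theta> * Y x powr \<beta> = D * (A \<theta> powr a * Y x powr \<beta>) - D * (A \<theta> powr \<beta> * Y x powr \<beta>)
            - c * (B \<theta> powr a * Y x powr \<beta> + M \<theta> * Y x powr \<beta>)"
          by (simp add: k_def algebra_simps)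
        also have "\<dots> \<le> D * (A \<theta> powr a * Y x powr \<beta>) - D * v powr \<beta>
            - c * (B \<theta> powr a + M \<theta> * Y x powr \<beta>)"
          using 2 3 c D by (intro diff_mono mult_left_mono add_right_mono order_refl) auto
        also have "\<dots> \<le> (v powr a - D * v powr \<beta>) - A \<theta> powr a * u (Y x)"
          using 1 unfolding 4 by linarith
        also have "\<dots> \<le> u v - A \<theta> powr a * u (Y x)" by (simp add: u_def)
        also have "\<dots> \<le> u (Y' z) - A \<theta> powr a * u (Y x)" using u_mono v by simp
        finally show ?thesis using True by (simp add: z \<psi>_pow AZ l_def)
      qed
    qed
    \<comment> \<open>By independence the mean of the product factors, and both factors are known to
      be positive.\<close>
    have "(\<integral>\<theta>. k \<theta> \<partial>P) * (\<integral>x. l x \<partial>N) = (\<integral>(\<theta>, x). k \<theta> * l x \<partial>(P \<Otimes>\<^sub>M N))"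
      by (rule PN.integral_pair_mult[OF k_int l_int, symmetric])
    also have "\<dots> \<le> (\<integral>z. \<psi> (Y' z) powr a - (A (fst z) * \<psi> (Y (snd z))) powr a \<partial>(P \<Otimes>\<^sub>M N))"
      using lower by (intro integral_mono_AE PN.integrable_pair_mult k_int l_int Zdiff) (auto simp: case_prod_unfold)
    finally have "0 < (\<integral>z. \<psi> (Y' z) powr a - (A (fst z) * \<psi> (Y (snd z))) powr a \<partial>(P \<Otimes>\<^sub>M N))"
      using k_ge l_pos by (smt (verit) mult_pos_pos)
    then have "0 < C'" using a m by (simp add: C'_def)
    also have "C' \<le> C"
    proof (rule tendsto_le[OF _ lim lim'])
      have "t powr a * measure N {x \<in> space N. t < \<psi> (Y x)} \<le> t powr a * measure N {x \<in> space N. t < Y x}" for t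
        by (intro mult_left_mono N.finite_measure_mono) (use \<psi>_le Y_nonneg in \<open>force intro: less_le_trans\<close>)+
      then show "\<forall>\<^sub>F t in at_top. t powr a * measure N {x \<in> space N. t < \<psi> (Y x)} \<le> t powr a * measure N {x \<in> space N. t < Y x}"
        by (intro always_eventually allI)
    qed simp
    finally show ?thesis .
  qed
  with lim that show ?thesis by blast
qed

text \<open>For x \<le> 1, the bound ln y \<le> y - 1 at y = x^(-a) gives x^a |ln x| \<le> 1/a. Thus
  control of the positive part of the logarithm yields a finite tilted mean.\<close>

lemma powr_mult_abs_ln_le:
  fixes x a :: real
  assumes "0 < x" "0 < a"
  shows "\<bar>x powr a * ln x\<bar> \<le> x powr a * lnplus x + 1 / a"
proof (cases "x \<le> 1")
  case True
  have "- (a * ln x) = ln (x powr (- a))" using assms by (simp add: ln_powr)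
  also have "\<dots> \<le> x powr (- a) - 1" using assms by (intro ln_le_minus_one) simp
  also have "\<dots> \<le> 1 / x powr a" by (simp add: powr_minus_divide)
  finally have "x powr a * (- (a * ln x)) \<le> 1"
    using assms by (simp add: field_simps)
  then have "x powr a * (- ln x) \<le> 1 / a" using assms by (simp add: field_simps)
  moreover have "ln x \<le> 0" using True assms by simp
  ultimately show ?thesis using True by (simp add: lnplus_def abs_mult)
qed (use assms in \<open>auto simp: lnplus_def abs_mult\<close>)

section \<open>Reduction of the theorem to the positive part of the stationary law\<close>

theorem theorem3p9:
  fixes P :: "'a::metric_space measure"
    and \<Psi> :: "'a \<Rightarrow> real \<Rightarrow> real"
    and A B :: "'a \<Rightarrow> real"
    and \<nu> :: "real measure"
    and \<alpha> :: real
  assumes P_prob: "prob_space P" and P_sets: "sets P = sets borel"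
    and \<Psi>_meas: "(\<lambda>(\<theta>, x). \<Psi> \<theta> x) \<in> borel_measurable (P \<Otimes>\<^sub>M lborel)"
    and \<Psi>_lip: "\<And>\<theta>. \<exists>L. L-lipschitz_on UNIV (\<Psi> \<theta>)"
    and \<Psi>_cont: "\<And>x. continuous_on UNIV (\<lambda>\<theta>. \<Psi> \<theta> x)"
    and lip_neg: "neg_log_mean P (\<lambda>\<theta>. lip_const (\<Psi> \<theta>))"
    and psi0: "(\<integral>\<^sup>+ \<theta>. ennreal (lnplus \<bar>\<Psi> \<theta> 0\<bar>) \<partial>P) < \<infinity>"
    and \<nu>_prob: "prob_space \<nu>" and \<nu>_sets: "sets \<nu> = sets borel"
    and stationary: "\<nu> = distr (P \<Otimes>\<^sub>M \<nu>) borel (\<lambda>(\<theta>, x). \<Psi> \<theta> x)"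
    and A_meas: "A \<in> borel_measurable P" and B_meas: "B \<in> borel_measurable P"
    and A_pos: "AE \<theta> in P. A \<theta> > 0"
    and bounds: "AE \<theta> in P. \<forall>x\<in>msupp \<nu>.
                   A \<theta> * x - B \<theta> \<le> \<Psi> \<theta> x \<and> \<Psi> \<theta> x \<le> A \<theta> * x + B \<theta>"
    and A_neg: "neg_log_mean P A"
    and \<alpha>_pos: "\<alpha> > 0"
    and A_mom: "(\<integral>\<^sup>+ \<theta>. ennreal (A \<theta> powr \<alpha>) \<partial>P) = 1"
    and AB_mom: "(\<integral>\<^sup>+ \<theta>. ennreal (\<bar>B \<theta>\<bar> powr \<alpha> + A \<theta> powr \<alpha> * lnplus (A \<theta>)) \<partial>P) < \<infinity>"
    and nonarith: "\<not> (\<exists>c>0. AE \<theta> in P. ln (A \<theta>) \<in> {c * of_int k | k. True})"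
  shows "\<exists>C. ((\<lambda>t. t powr \<alpha> * measure \<nu> {t<..}) \<longlongrightarrow> C) at_top
             \<and> (\<not> bdd_above (msupp \<nu>) \<longrightarrow> C > 0)"
proof -
  interpret P: prob_space P by fact
  interpret \<nu>: prob_space \<nu> by fact
  interpret P\<nu>: pair_prob_space P \<nu> ..
  note [measurable] = A_meas B_meas
  note [measurable_cong] = \<nu>_sets
  \<comment> \<open>A change on a null set makes the multiplier positive everywhere, as
    \<open>stationary_tail\<close> requires.\<close>
  define A' where "A' \<theta> = (if A \<theta> > 0 then A \<theta> else 1)" for \<theta>
  define B' where "B' \<theta> = \<bar>B \<theta>\<bar>" for \<theta>
  have A'_pos: "0 < A' \<theta>" for \<theta> by (simp add: A'_def)
  have A'_meas [measurable]: "A' \<in> borel_measurable P" unfolding A'_def by measurable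
  have B'_meas [measurable]: "B' \<in> borel_measurable P" unfolding B'_def by measurable
  have A'_eq: "AE \<theta> in P. A' \<theta> = A \<theta>" using A_pos by eventually_elim (simp add: A'_def)
  have lnplus_meas [measurable]: "lnplus \<in> borel_measurable borel" unfolding lnplus_def by measurable
  have lnplus_nonneg: "0 \<le> lnplus x" for x by (simp add: lnplus_def)
  have A_mom': "(\<integral>\<^sup>+ \<theta>. ennreal (A' \<theta> powr \<alpha>) \<partial>P) = ennreal 1"
    unfolding ennreal_1 A_mom[symmetric] using A'_eq by (intro nn_integral_cong_AE) auto
  have A_int: "integrable P (\<lambda>\<theta>. A' \<theta> powr \<alpha>)"
    by (rule integrableI_nn_integral_finite[OF _ _ A_mom']) auto
  have A_int1: "(\<integral>\<theta>. A' \<theta> powr \<alpha> \<partial>P) = 1"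
    using A_mom' nn_integral_eq_integral[OF A_int] by simp
  define S where "S \<theta> = \<bar>B \<theta>\<bar> powr \<alpha> + A \<theta> powr \<alpha> * lnplus (A \<theta>)" for \<theta>
  have S_int: "integrable P S"
  proof (rule integrableI_bounded)
    show "S \<in> borel_measurable P" unfolding S_def by measurable
    show "(\<integral>\<^sup>+ \<theta>. ennreal (norm (S \<theta>)) \<partial>P) < \<infinity>"
      using AB_mom lnplus_nonneg by (simp add: S_def abs_of_nonneg)
  qed
  have B_int: "integrable P (\<lambda>\<theta>. B' \<theta> powr \<alpha>)"
    by (rule Bochner_Integration.integrable_bound[OF S_int])
       (use lnplus_nonneg in \<open>auto simp: S_def B'_def abs_of_nonneg\<close>)
  have A_log: "integrable P (\<lambda>\<theta>. A' \<theta> powr \<alpha> * ln (A' \<theta>))"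
  proof (rule Bochner_Integration.integrable_bound)
    show "integrable P (\<lambda>\<theta>. S \<theta> + 1 / \<alpha>)" using S_int by simp
    show "AE \<theta> in P. norm (A' \<theta> powr \<alpha> * ln (A' \<theta>)) \<le> norm (S \<theta> + 1 / \<alpha>)"
      using A'_eq
    proof eventually_elim
      case (elim \<theta>)
      have "\<bar>A' \<theta> powr \<alpha> * ln (A' \<theta>)\<bar> \<le> A' \<theta> powr \<alpha> * lnplus (A' \<theta>) + 1 / \<alpha>"
        by (rule powr_mult_abs_ln_le[OF A'_pos \<alpha>_pos])
      also have "\<dots> \<le> S \<theta> + 1 / \<alpha>" using elim by (simp add: S_def)
      finally show ?case by simp
    qed
  qed measurable
  have nonarith': "\<not> (\<exists>c>0. AE \<theta> in P. ln (A' \<theta>) \<in> {c * of_int k | k. True})"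
  proof
    assume "\<exists>c>0. AE \<theta> in P. ln (A' \<theta>) \<in> {c * of_int k | k. True}"
    then obtain c where c: "c > 0" "AE \<theta> in P. ln (A' \<theta>) \<in> {c * of_int k | k. True}" by blast
    from c(2) A'_eq have "AE \<theta> in P. ln (A \<theta>) \<in> {c * of_int k | k. True}"
      by eventually_elim simp
    with c(1) nonarith show False by blast
  qed
  have sets_eq: "sets (P \<Otimes>\<^sub>M \<nu>) = sets (P \<Otimes>\<^sub>M lborel)"
    by (rule sets_pair_measure_cong) (simp_all add: \<nu>_sets)
  have \<Psi>_meas' [measurable]: "(\<lambda>(\<theta>, x). \<Psi> \<theta> x) \<in> borel_measurable (P \<Otimes>\<^sub>M \<nu>)"
    using \<Psi>_meas measurable_cong_sets[OF sets_eq refl] by blast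
  then have \<Psi>_meas'' [measurable]: "(\<lambda>z. \<Psi> (fst z) (snd z)) \<in> borel_measurable (P \<Otimes>\<^sub>M \<nu>)"
    by (simp add: case_prod_unfold)
  define Y :: "real \<Rightarrow> real" where "Y x = max 0 x" for x
  define Y' where "Y' z = max 0 (\<Psi> (fst z) (snd z))" for z
  have [measurable]: "Y \<in> borel_measurable borel" unfolding Y_def by measurable
  have Y_meas: "Y \<in> borel_measurable \<nu>" unfolding Y_def by measurable
  have Y'_meas [measurable]: "Y' \<in> borel_measurable (P \<Otimes>\<^sub>M \<nu>)" unfolding Y'_def by measurable
  have law: "distr (P \<Otimes>\<^sub>M \<nu>) borel Y' = distr \<nu> borel Y"
  proof -
    have "distr \<nu> borel Y = distr (distr (P \<Otimes>\<^sub>M \<nu>) borel (\<lambda>(\<theta>, x). \<Psi> \<theta> x)) borel Y"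
      by (rule arg_cong[OF stationary])
    also have "\<dots> = distr (P \<Otimes>\<^sub>M \<nu>) borel (Y \<circ> (\<lambda>(\<theta>, x). \<Psi> \<theta> x))"
      by (rule distr_distr) measurable
    also have "Y \<circ> (\<lambda>(\<theta>, x). \<Psi> \<theta> x) = Y'" by (auto simp: Y_def Y'_def fun_eq_iff)
    finally show ?thesis by simp
  qed
  have close: "AE z in P \<Otimes>\<^sub>M \<nu>. \<bar>Y' z - A' (fst z) * Y (snd z)\<bar> \<le> B' (fst z)"
  proof (rule P\<nu>.AE_pair_measure)
    show "{z \<in> space (P \<Otimes>\<^sub>M \<nu>). \<bar>Y' z - A' (fst z) * Y (snd z)\<bar> \<le> B' (fst z)} \<in> sets (P \<Otimes>\<^sub>M \<nu>)"
      by measurable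
    \<comment> \<open>The two-sided bound is available on the support, which has full measure by
      \<open>AE_msupp\<close>.\<close>
    have supp: "AE x in \<nu>. x \<in> msupp \<nu>"
      by (rule AE_msupp) (auto simp: \<nu>_sets intro: \<nu>.finite_measure_axioms)
    show "AE \<theta> in P. AE x in \<nu>. \<bar>Y' (\<theta>, x) - A' (fst (\<theta>, x)) * Y (snd (\<theta>, x))\<bar> \<le> B' (fst (\<theta>, x))"
      using bounds A'_eq
    proof eventually_elim
      case (elim \<theta>)
      show ?case
        using supp
      proof eventually_elim
        case (elim x)
        with \<open>\<forall>x\<in>msupp \<nu>. _\<close> \<open>A' \<theta> = A \<theta>\<close>
        have "A' \<theta> * x - B \<theta> \<le> \<Psi> \<theta> x" "\<Psi> \<theta> x \<le> A' \<theta> * x + B \<theta>" by auto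
        then have "\<bar>\<Psi> \<theta> x - A' \<theta> * x\<bar> \<le> B' \<theta>" unfolding B'_def by linarith
        \<comment> \<open>The positive part commutes with multiplication by a positive number and is
          1-Lipschitz, so the error bound \<open>B'\<close> survives.\<close>
        moreover have "A' \<theta> * Y x = max 0 (A' \<theta> * x)"
          using A'_pos[of \<theta>] by (simp add: Y_def max_mult_distrib_left)
        ultimately show ?case by (simp add: Y'_def)
      qed
    qed
  qed
  obtain C where C: "((\<lambda>t. t powr \<alpha> * measure \<nu> {x \<in> space \<nu>. t < Y x}) \<longlongrightarrow> C) at_top"
    and C_pos: "(\<And>K. measure \<nu> {x \<in> space \<nu>. K < Y x} > 0) \<Longrightarrow> C > 0"
    by (rule stationary_tail[OF P_prob \<nu>_prob A'_meas A'_pos B'_meas _ \<alpha>_pos A_int A_int1 A_log B_int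
          nonarith' Y_meas _ Y'_meas _ law close]) (auto simp: B'_def Y_def Y'_def)
  have space: "space \<nu> = UNIV" using sets_eq_imp_space_eq[OF \<nu>_sets] by simp
  have "\<forall>\<^sub>F t in at_top. t powr \<alpha> * measure \<nu> {x \<in> space \<nu>. t < Y x} = t powr \<alpha> * measure \<nu> {t<..}"
    using eventually_ge_at_top[of 0]
  proof eventually_elim
    case (elim t)
    then have "{x \<in> space \<nu>. t < Y x} = {t<..}" by (auto simp: space Y_def)
    then show ?case by simp
  qed
  with C have lim: "((\<lambda>t. t powr \<alpha> * measure \<nu> {t<..}) \<longlongrightarrow> C) at_top"
    by (rule Lim_transform_eventually)
  have "C > 0" if unbdd: "\<not> bdd_above (msupp \<nu>)"
  proof (rule C_pos)
    fix K
    \<comment> \<open>The unit ball around \<open>s\<close> lies above |K|, where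
      \<open>Y x = x\<close>, and has positive mass.\<close>
    obtain s where s: "s \<in> msupp \<nu>" "s > \<bar>K\<bar> + 1"
      using unbdd unfolding bdd_above_def by (meson not_le)
    have "0 < emeasure \<nu> (ball s 1)" using s(1) by (simp add: msupp_def)
    then have "0 < measure \<nu> (ball s 1)" by (simp add: \<nu>.emeasure_eq_measure)
    also have "measure \<nu> (ball s 1) \<le> measure \<nu> {x \<in> space \<nu>. K < Y x}"
    proof (rule \<nu>.finite_measure_mono)
      show "ball s 1 \<subseteq> {x \<in> space \<nu>. K < Y x}"
        using s(2) by (auto simp: space Y_def dist_real_def abs_less_iff)
      show "{x \<in> space \<nu>. K < Y x} \<in> sets \<nu>" using Y_meas by measurable
    qed
    finally show "0 < measure \<nu> {x \<in> space \<nu>. K < Y x}" .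
  qed
  with lim show ?thesis by blast
qed

end
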